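(* Let $(\mathcal{A},\Gamma^+,\alpha)$ be a finely representable C*-dynamical system with unique complete transfer action $L$, let $\mathcal{A}\rtimes_\alpha\Gamma$ be its crossed product, and let $a\in C_0$, i.e. $a=\sum_{x\in F}u_x^*a_{-x}+a_0+\sum_{x\in F}a_xu_x$ with $F\subset\Gamma^+\setminus\{0\}$ finite, $a_0\in\mathcal{A}$, $a_x\in\mathcal{A}u_xu_x^*$, $a_{-x}\in u_xu_x^*\mathcal{A}$. Then $$\|a\|=\lim_{k\to\infty}\big\|E_0[(a a^* )^{2k}]\big\|^{1/(4k)}.$$
   Context: $\mathcal{A}$ is a C*-algebra with identity $1$, $\Gamma$ a totally ordered abelian group with identity $0$, $\Gamma^+=\{x\in\Gamma:0\le x\}$, and $\alpha:\Gamma^+\to\mathrm{End}(\mathcal{A})$ a semigroup homomorphism into $*$-endomorphisms ($\alpha_0=\mathrm{Id}$, $\alpha_x\circ\alpha_y=\alpha_{x+y}$). The system is finely representable if there exist a Hilbert space $H$, a faithful non-degenerate representation $\pi:\mathcal{A}\to L(H)$ and a semigroup homomorphism $U:\Gamma^+\to L(H)$ with $\pi(\alpha_x(a))=U_x\pi(a)U_x^*$, $U_x^*\pi(a)U_x\in\pi(\mathcal{A})$ and $U_x\pi(a)=\pi(\alpha_x(a))U_x$. A complete transfer action is a family $\{L_x\}_{x\in\Gamma^+}$ of continuous linear positive maps on $\mathcal{A}$ with $L_{x+y}=L_y\circ L_x$, $L_x(\alpha_x(a)b)=aL_x(b)$ and $\alpha_x(L_x(a))=\alpha_x(1)a\alpha_x(1)$;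 for a finely representable system it exists and is unique. $l_1(\Gamma,\alpha,\mathcal{A})$ is the set of families $\{a_g\}_{g\in\Gamma}$ in $\mathcal{A}$ with $a_x\in\mathcal{A}\alpha_x(1)$, $a_{-x}\in\alpha_x(1)\mathcal{A}$ ($x\in\Gamma^+$) and $\sum_g\|a_g\|<\infty$, with pointwise linear operations, involution $(a^* )_g=(a_{-g})^*$ and multiplication given for $0\le g$ by $(a\cdot b)_g=\sum_{g=x-y,\,x,y>0}a_x\alpha_{x-y}(b_{-y})+\sum_{g=y-x,\,x,y>0}L_x(a_{-x}b_y)+\sum_{g=x+y,\,x,y\ge0}a_x\alpha_x(b_y)$ and for $g<0$ by $(a\cdot b)_g=\sum_{g=x-y,\,x,y>0}\alpha_{y-x}(a_x)b_{-y}+\sum_{g=y-x,\,x,y>0}L_y(a_{-x}b_y)+\sum_{g=-x-y,\,x,y\ge0}\alpha_y(a_{-x})b_{-y}$; $c\delta_{g_0}$ denotes the family with $c$ at index $g_0$ and $0$ elsewhere. The crossed product $\mathcal{A}\rtimes_\alpha\Gamma$ is the enveloping C*-algebra of $l_1(\Gamma,\alpha,\mathcal{A})$, with $\mathcal{A}$ identified with the image of $a\mapsto a\delta_0$; $u_x$ is the image of $\alpha_x(1)\delta_x$ for $x\in\Gamma^+$. $C_0$ is the dense $*$-subalgebra of elements of the form above; their coefficients $a_g$ are uniquely determined, and $E_0:C_0\to\mathcal{A}$ is the map $E_0(a)=a_0$. *)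

theory Defs
  imports "HOL-Analysis.Analysis"
begin

text \<open>A complex vector space is modelled as a real vector space together with a
  complex scalar action extending the real one.\<close>

definition complex_action :: "(complex \<Rightarrow> 'v::real_vector \<Rightarrow> 'v) \<Rightarrow> bool" where
  "complex_action sc \<longleftrightarrow>
     (\<forall>c d v. sc (c + d) v = sc c v + sc d v) \<and>
     (\<forall>c v w. sc c (v + w) = sc c v + sc c w) \<and>
     (\<forall>c d v. sc (c * d) v = sc c (sc d v)) \<and>
     (\<forall>r v. sc (complex_of_real r) v = r *\<^sub>R v)"

definition cstar_algebra ::
  "(complex \<Rightarrow> 'a::{real_normed_algebra_1,banach} \<Rightarrow> 'a) \<Rightarrow> ('a \<Rightarrow> 'a) \<Rightarrow> bool" where
  "cstar_algebra sc st \<longleftrightarrow>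
     complex_action sc \<and>
     (\<forall>c x. norm (sc c x) = cmod c * norm x) \<and>
     (\<forall>c x y. sc c (x * y) = sc c x * y \<and> sc c (x * y) = x * sc c y) \<and>
     (\<forall>x. st (st x) = x) \<and>
     (\<forall>x y. st (x + y) = st x + st y) \<and>
     (\<forall>c x. st (sc c x) = sc (cnj c) (st x)) \<and>
     (\<forall>x y. st (x * y) = st y * st x) \<and>
     (\<forall>x. norm (st x * x) = (norm x)\<^sup>2)"

definition star_endo ::
  "(complex \<Rightarrow> 'a::{real_normed_algebra_1,banach} \<Rightarrow> 'a) \<Rightarrow> ('a \<Rightarrow> 'a) \<Rightarrow> ('a \<Rightarrow> 'a) \<Rightarrow> bool" where
  "star_endo sc st f \<longleftrightarrow>
     (\<forall>x y. f (x + y) = f x + f y) \<and>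
     (\<forall>c x. f (sc c x) = sc c (f x)) \<and>
     (\<forall>x y. f (x * y) = f x * f y) \<and>
     (\<forall>x. f (st x) = st (f x))"

text \<open>Semigroup homomorphism from the positive cone of a totally ordered abelian group
  into the *-endomorphisms of the algebra (only the values at x \<ge> 0 matter).\<close>

definition endo_action ::
  "(complex \<Rightarrow> 'a::{real_normed_algebra_1,banach} \<Rightarrow> 'a) \<Rightarrow> ('a \<Rightarrow> 'a) \<Rightarrow>
   ('g::linordered_ab_group_add \<Rightarrow> 'a \<Rightarrow> 'a) \<Rightarrow> bool" where
  "endo_action sc st \<alpha> \<longleftrightarrow>
     (\<forall>x\<ge>0. star_endo sc st (\<alpha> x)) \<and>
     \<alpha> 0 = id \<and>
     (\<forall>x y. 0 \<le> x \<longrightarrow> 0 \<le> y \<longrightarrow> \<alpha> (x + y) = \<alpha> x \<circ> \<alpha> y)"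

definition hilbert_space ::
  "(complex \<Rightarrow> 'h::banach \<Rightarrow> 'h) \<Rightarrow> ('h \<Rightarrow> 'h \<Rightarrow> complex) \<Rightarrow> bool" where
  "hilbert_space sch ip \<longleftrightarrow>
     complex_action sch \<and>
     (\<forall>u v w. ip (u + v) w = ip u w + ip v w) \<and>
     (\<forall>c u w. ip (sch c u) w = c * ip u w) \<and>
     (\<forall>u v. ip u v = cnj (ip v u)) \<and>
     (\<forall>u. norm u = sqrt (Re (ip u u)))"

definition bounded_op :: "(complex \<Rightarrow> 'h::banach \<Rightarrow> 'h) \<Rightarrow> ('h \<Rightarrow> 'h) \<Rightarrow> bool" where
  "bounded_op sch T \<longleftrightarrow> bounded_linear T \<and> (\<forall>c v. T (sch c v) = sch c (T v))"

definition adjoint :: "('h \<Rightarrow> 'h \<Rightarrow> complex) \<Rightarrow> ('h \<Rightarrow> 'h) \<Rightarrow> ('h \<Rightarrow> 'h)" where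
  "adjoint ip T = (THE S. \<forall>v w. ip (T v) w = ip v (S w))"

definition faithful_nondeg_rep ::
  "(complex \<Rightarrow> 'a::{real_normed_algebra_1,banach} \<Rightarrow> 'a) \<Rightarrow> ('a \<Rightarrow> 'a) \<Rightarrow>
   (complex \<Rightarrow> 'h::banach \<Rightarrow> 'h) \<Rightarrow> ('h \<Rightarrow> 'h \<Rightarrow> complex) \<Rightarrow> ('a \<Rightarrow> 'h \<Rightarrow> 'h) \<Rightarrow> bool" where
  "faithful_nondeg_rep sc st sch ip \<pi> \<longleftrightarrow>
     (\<forall>a. bounded_op sch (\<pi> a)) \<and>
     (\<forall>a b v. \<pi> (a + b) v = \<pi> a v + \<pi> b v) \<and>
     (\<forall>c a v. \<pi> (sc c a) v = sch c (\<pi> a v)) \<and>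
     (\<forall>a b. \<pi> (a * b) = \<pi> a \<circ> \<pi> b) \<and>
     (\<forall>a. \<pi> (st a) = adjoint ip (\<pi> a)) \<and>
     inj \<pi> \<and>
     closure (span {\<pi> a v | a v. True}) = UNIV"

definition finely_rep ::
  "(complex \<Rightarrow> 'a::{real_normed_algebra_1,banach} \<Rightarrow> 'a) \<Rightarrow> ('a \<Rightarrow> 'a) \<Rightarrow>
   ('g::linordered_ab_group_add \<Rightarrow> 'a \<Rightarrow> 'a) \<Rightarrow>
   (complex \<Rightarrow> 'h::banach \<Rightarrow> 'h) \<Rightarrow> ('h \<Rightarrow> 'h \<Rightarrow> complex) \<Rightarrow> ('a \<Rightarrow> 'h \<Rightarrow> 'h) \<Rightarrow>
   ('g \<Rightarrow> 'h \<Rightarrow> 'h) \<Rightarrow> bool" where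
  "finely_rep sc st \<alpha> sch ip \<pi> U \<longleftrightarrow>
     hilbert_space sch ip \<and>
     faithful_nondeg_rep sc st sch ip \<pi> \<and>
     (\<forall>x\<ge>0. bounded_op sch (U x)) \<and>
     U 0 = id \<and>
     (\<forall>x y. 0 \<le> x \<longrightarrow> 0 \<le> y \<longrightarrow> U (x + y) = U x \<circ> U y) \<and>
     (\<forall>x a. 0 \<le> x \<longrightarrow>
        \<pi> (\<alpha> x a) = U x \<circ> \<pi> a \<circ> adjoint ip (U x) \<and>
        adjoint ip (U x) \<circ> \<pi> a \<circ> U x \<in> range \<pi> \<and>
        U x \<circ> \<pi> a = \<pi> (\<alpha> x a) \<circ> U x)"

definition positive_map ::
  "('a::{real_normed_algebra_1,banach} \<Rightarrow> 'a) \<Rightarrow> ('a \<Rightarrow> 'a) \<Rightarrow> bool" where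
  "positive_map st T \<longleftrightarrow> (\<forall>b. \<exists>c. T (st b * b) = st c * c)"

definition complete_transfer ::
  "(complex \<Rightarrow> 'a::{real_normed_algebra_1,banach} \<Rightarrow> 'a) \<Rightarrow> ('a \<Rightarrow> 'a) \<Rightarrow>
   ('g::linordered_ab_group_add \<Rightarrow> 'a \<Rightarrow> 'a) \<Rightarrow> ('g \<Rightarrow> 'a \<Rightarrow> 'a) \<Rightarrow> bool" where
  "complete_transfer sc st \<alpha> L \<longleftrightarrow>
     (\<forall>x\<ge>0. bounded_linear (L x) \<and> (\<forall>c a. L x (sc c a) = sc c (L x a)) \<and>
             positive_map st (L x)) \<and>
     (\<forall>x y. 0 \<le> x \<longrightarrow> 0 \<le> y \<longrightarrow> L (x + y) = L y \<circ> L x) \<and>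
     (\<forall>x a b. 0 \<le> x \<longrightarrow> L x (\<alpha> x a * b) = a * L x b) \<and>
     (\<forall>x a. 0 \<le> x \<longrightarrow> \<alpha> x (L x a) = \<alpha> x 1 * a * \<alpha> x 1)"

definition l1_set ::
  "('g::linordered_ab_group_add \<Rightarrow> 'a::{real_normed_algebra_1,banach} \<Rightarrow> 'a) \<Rightarrow> ('g \<Rightarrow> 'a) set" where
  "l1_set \<alpha> = {a. (\<forall>x\<ge>0. (\<exists>c. a x = c * \<alpha> x 1) \<and> (\<exists>c. a (- x) = \<alpha> x 1 * c)) \<and>
                   (\<lambda>g. norm (a g)) summable_on UNIV}"

definition l1_norm :: "('g \<Rightarrow> 'a::real_normed_vector) \<Rightarrow> real" where
  "l1_norm a = infsum (\<lambda>g. norm (a g)) UNIV"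

definition l1_star :: "('a \<Rightarrow> 'a) \<Rightarrow> ('g::ab_group_add \<Rightarrow> 'a) \<Rightarrow> 'g \<Rightarrow> 'a" where
  "l1_star st a = (\<lambda>g. st (a (- g)))"

definition l1_mult ::
  "('g::linordered_ab_group_add \<Rightarrow> 'a::{real_normed_algebra_1,banach} \<Rightarrow> 'a) \<Rightarrow> ('g \<Rightarrow> 'a \<Rightarrow> 'a) \<Rightarrow>
   ('g \<Rightarrow> 'a) \<Rightarrow> ('g \<Rightarrow> 'a) \<Rightarrow> 'g \<Rightarrow> 'a" where
  "l1_mult \<alpha> L a b = (\<lambda>g.
     if 0 \<le> g then
       infsum (\<lambda>(x, y). a x * \<alpha> (x - y) (b (- y))) {(x, y). 0 < x \<and> 0 < y \<and> g = x - y}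
     + infsum (\<lambda>(x, y). L x (a (- x) * b y)) {(x, y). 0 < x \<and> 0 < y \<and> g = y - x}
     + infsum (\<lambda>(x, y). a x * \<alpha> x (b y)) {(x, y). 0 \<le> x \<and> 0 \<le> y \<and> g = x + y}
     else
       infsum (\<lambda>(x, y). \<alpha> (y - x) (a x) * b (- y)) {(x, y). 0 < x \<and> 0 < y \<and> g = x - y}
     + infsum (\<lambda>(x, y). L y (a (- x) * b y)) {(x, y). 0 < x \<and> 0 < y \<and> g = y - x}
     + infsum (\<lambda>(x, y). \<alpha> y (a (- x)) * b (- y)) {(x, y). 0 \<le> x \<and> 0 \<le> y \<and> g = - x - y})"

definition l1_one :: "'g::zero \<Rightarrow> 'a::{zero,one}" where
  "l1_one = (\<lambda>g. if g = 0 then 1 else 0)"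

definition l1_pow ::
  "('g::linordered_ab_group_add \<Rightarrow> 'a::{real_normed_algebra_1,banach} \<Rightarrow> 'a) \<Rightarrow> ('g \<Rightarrow> 'a \<Rightarrow> 'a) \<Rightarrow>
   ('g \<Rightarrow> 'a) \<Rightarrow> nat \<Rightarrow> 'g \<Rightarrow> 'a" where
  "l1_pow \<alpha> L a n = ((\<lambda>z. l1_mult \<alpha> L a z) ^^ n) l1_one"

text \<open>C*-seminorms on l1 (dominated by the l1-norm); the norm of the enveloping
  C*-algebra (the crossed product) of an element of l1 is the supremum of all of them.\<close>

definition cstar_seminorm ::
  "(complex \<Rightarrow> 'a::{real_normed_algebra_1,banach} \<Rightarrow> 'a) \<Rightarrow> ('a \<Rightarrow> 'a) \<Rightarrow>
   ('g::linordered_ab_group_add \<Rightarrow> 'a \<Rightarrow> 'a) \<Rightarrow> ('g \<Rightarrow> 'a \<Rightarrow> 'a) \<Rightarrow> (('g \<Rightarrow> 'a) \<Rightarrow> real) \<Rightarrow> bool" where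
  "cstar_seminorm sc st \<alpha> L p \<longleftrightarrow>
     (\<forall>a\<in>l1_set \<alpha>. \<forall>b\<in>l1_set \<alpha>. \<forall>c.
        0 \<le> p a \<and>
        p (\<lambda>g. a g + b g) \<le> p a + p b \<and>
        p (\<lambda>g. sc c (a g)) = cmod c * p a \<and>
        p (l1_mult \<alpha> L a b) \<le> p a * p b \<and>
        p (l1_mult \<alpha> L (l1_star st a) a) = (p a)\<^sup>2 \<and>
        p a \<le> l1_norm a)"

definition crossed_norm ::
  "(complex \<Rightarrow> 'a::{real_normed_algebra_1,banach} \<Rightarrow> 'a) \<Rightarrow> ('a \<Rightarrow> 'a) \<Rightarrow>
   ('g::linordered_ab_group_add \<Rightarrow> 'a \<Rightarrow> 'a) \<Rightarrow> ('g \<Rightarrow> 'a \<Rightarrow> 'a) \<Rightarrow> ('g \<Rightarrow> 'a) \<Rightarrow> real" where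
  "crossed_norm sc st \<alpha> L a = Sup {p a | p. cstar_seminorm sc st \<alpha> L p}"

definition C0_set :: "('g::linordered_ab_group_add \<Rightarrow> 'a::{real_normed_algebra_1,banach} \<Rightarrow> 'a) \<Rightarrow> ('g \<Rightarrow> 'a) set" where
  "C0_set \<alpha> = {a \<in> l1_set \<alpha>. finite {g. a g \<noteq> 0}}"

definition E0 :: "('g::zero \<Rightarrow> 'a) \<Rightarrow> 'a" where
  "E0 a = a 0"

end

theory Submission
  imports Defs "HOL-Real_Asymp.Real_Asymp"
begin

text \<open>
  For a C*-seminorm \<open>p\<close> on the l1-algebra, \<open>h = a a\<^sup>*\<close> and \<open>b = h\<^sup>k\<close>, the coefficient
  \<open>E\<^sub>0(b b\<^sup>*) = E\<^sub>0(h\<^sup>2\<^sup>k)\<close> is a sum of positive elements and has norm at least \<open>\<parallel>b\<^sub>g\<parallel>\<^sup>2\<close> for every \<open>g\<close>, so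
  \<open>p(a)\<^sup>2\<^sup>k = p(b)\<close> is at most \<open>\<parallel>E\<^sub>0(h\<^sup>2\<^sup>k)\<parallel>\<^sup>1\<^sup>/\<^sup>2\<close> times the number of elements of the support of \<open>b\<close>.
  This number grows polynomially in \<open>k\<close> because the group is abelian, and its contribution
  disappears in the limit. Conversely, twisting the given covariant representation by characters of
  the group gives C*-seminorms whose supremum dominates \<open>\<parallel>E\<^sub>0(\<cdot>)\<parallel>\<close> on \<open>C\<^sub>0\<close>: an ordered group is
  torsion free, so averaging over finitely many characters isolates the coefficient at \<open>0\<close>. The
  latter step needs that the faithful representation is isometric.
\<close>

section \<open>Square roots in C*-algebras\<close>

text \<open>The product of the l1-algebra is defined by sign cases, and checking associativity on
  coefficients would multiply those cases. Instead, \<open>B_compose\<close> identifies the product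
  of two monomials with a product of operators once and for all, and \<open>C0_eqI\<close> shows
  that the representations \<open>T \<omega>\<close> together separate the points of C_0. The
  algebraic laws needed on C_0 are then read off from operators. The exponents arise as follows.
  Since b = h^k is self-adjoint, b b^* is h^(2k), whose coefficient at 0 controls the squares of the
  norms of all coefficients of b. The root 1/(4k) combines this square, the power k and p(h) =
  p(a)^2. That an injective representation is isometric is usually read off from the spectrum. Here
  it is reduced to square roots, hence the results on roots in the algebra and on the Hilbert
  space.\<close>

locale cstar =
  fixes sc :: "complex \<Rightarrow> 'a::{real_normed_algebra_1,banach} \<Rightarrow> 'a" and st :: "'a \<Rightarrow> 'a"
  assumes cstar: "cstar_algebra sc st"
begin

lemma sc_mult: "sc (c * d) x = sc c (sc d x)"
  and sc_of_real: "sc (complex_of_real r) x = r *\<^sub>R x"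
  and norm_sc: "norm (sc c x) = cmod c * norm x"
  and sc_mult_left: "sc c x * y = sc c (x * y)"
  and sc_mult_right: "x * sc c y = sc c (x * y)"
  and st_st [simp]: "st (st x) = x"
  and st_add: "st (x + y) = st x + st y"
  and st_sc: "st (sc c x) = sc (cnj c) (st x)"
  and st_mult: "st (x * y) = st y * st x"
  and norm_st_mult_self: "norm (st x * x) = (norm x)\<^sup>2"
  using cstar unfolding cstar_algebra_def complex_action_def by metis+

lemma sc_add_right: "sc c (x + y) = sc c x + sc c y"
  using cstar unfolding cstar_algebra_def complex_action_def by metis

lemma sc_diff_right: "sc c (x - y) = sc c x - sc c y"
  using sc_add_right[of c "x - y" y] by simp

lemma st_scaleR: "st (r *\<^sub>R x) = r *\<^sub>R st x"
  using st_sc[of "complex_of_real r" x] by (simp add: sc_of_real)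

lemma linear_st: "linear st"
  by (rule linearI) (simp_all add: st_add st_scaleR)

lemma st_diff: "st (x - y) = st x - st y" and st_zero [simp]: "st 0 = 0"
  using linear_st by (simp_all add: linear_diff linear_0)

lemma st_one [simp]: "st 1 = 1"
proof -
  have "st 1 * 1 = st (st 1 * 1)" using st_mult[of "st 1" 1] by simp
  then show ?thesis by simp
qed

lemma norm_st [simp]: "norm (st x) = norm x"
proof -
  have le: "norm y \<le> norm (st y)" for y
  proof (cases "y = 0")
    case False
    have "norm y * norm y \<le> norm (st y) * norm y"
      using norm_mult_ineq[of "st y" y] by (simp add: norm_st_mult_self power2_eq_square)
    with False show ?thesis by simp
  qed auto
  from le[of x] le[of "st x"] show ?thesis by simp
qed

lemma bounded_linear_st: "bounded_linear st"
  using linear_st by (simp add: bounded_linear_def bounded_linear_axioms_def) (metis mult_1_right order_refl)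

text \<open>The iteration \<open>z \<mapsto> (x + z\<^sup>2) / 2\<close> is dominated by the same iteration for the
  scalar \<open>x = 1\<close>, which increases to \<open>1\<close>; its limit \<open>z\<close> satisfies \<open>(1 - z)\<^sup>2 = 1 - x\<close>.\<close>

lemma exists_sqrt_one_minus:
  fixes x :: 'a
  assumes x: "norm x \<le> 1" and sa: "st x = x"
  obtains s where "s * s = 1 - x" "st s = s" "norm (1 - s) \<le> 1"
    "\<And>y. y * x = x * y \<Longrightarrow> y * s = s * y"
proof -
  define z where "z = rec_nat (0::'a) (\<lambda>_ w. (1/2) *\<^sub>R (x + w * w))"
  define t where "t = rec_nat (0::real) (\<lambda>_ w. (1/2) * (1 + w * w))"
  have z0: "z 0 = 0" and zS: "\<And>n. z (Suc n) = (1/2) *\<^sub>R (x + z n * z n)"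
    and t0: "t 0 = 0" and tS: "\<And>n. t (Suc n) = (1/2) * (1 + t n * t n)"
    by (simp_all add: z_def t_def)
  have t_bounds: "0 \<le> t n \<and> t n \<le> 1" for n
  proof (induction n)
    case (Suc n)
    then have "t n * t n \<le> 1" by (simp add: mult_le_one)
    then show ?case by (simp add: tS)
  qed (simp add: t0)
  have nz: "norm (z n) \<le> t n" for n
  proof (induction n)
    case (Suc n)
    have "norm (z n * z n) \<le> t n * t n"
      by (rule order_trans[OF norm_mult_ineq mult_mono[OF Suc Suc]]) (use t_bounds in auto)
    then have "norm (x + z n * z n) \<le> 1 + t n * t n" using norm_triangle_mono x by blast
    then show ?case by (simp add: zS tS)
  qed (simp add: z0 t0)
  have step: "norm (z (Suc n) - z n) \<le> t (Suc n) - t n" for n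
  proof (induction n)
    case (Suc n)
    let ?w = "z (Suc n)" and ?w' = "z n"
    have "?w * ?w - ?w' * ?w' = ?w * (?w - ?w') + (?w - ?w') * ?w'" by (simp add: algebra_simps)
    also have "norm \<dots> \<le> t (Suc n) * (t (Suc n) - t n) + (t (Suc n) - t n) * t n"
      by (rule norm_triangle_mono; rule order_trans[OF norm_mult_ineq mult_mono])
         (use Suc nz t_bounds order_trans[OF norm_ge_zero Suc] in auto)
    also have "\<dots> = t (Suc n) * t (Suc n) - t n * t n" by (simp add: algebra_simps)
    finally have *: "norm (?w * ?w - ?w' * ?w') \<le> t (Suc n) * t (Suc n) - t n * t n" .
    have "z (Suc (Suc n)) - z (Suc n) = (1/2) *\<^sub>R (?w * ?w - ?w' * ?w')"
      unfolding zS[of "Suc n"] zS[of n] by (simp add: scaleR_right_diff_distrib scaleR_right_distrib)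
    moreover have "t (Suc (Suc n)) - t (Suc n) = (1/2) * (t (Suc n) * t (Suc n) - t n * t n)"
      unfolding tS[of "Suc n"] tS[of n] by (simp add: algebra_simps)
    ultimately show ?case using * by simp
  qed (use x in \<open>simp add: z0 t0 zS tS\<close>)
  have "summable (\<lambda>n. t (Suc n) - t n)"
  proof (rule summableI_nonneg_bounded)
    show "0 \<le> t (Suc n) - t n" for n using order_trans[OF norm_ge_zero step] .
    show "(\<Sum>n<N. t (Suc n) - t n) \<le> 1" for N
      using t_bounds[of N] by (simp add: sum_lessThan_telescope t0)
  qed
  then have "summable (\<lambda>n. z (Suc n) - z n)"
    by (rule summable_comparison_test'[where N = 0]) (use step in auto)
  then have "convergent (\<lambda>n. \<Sum>k<n. z (Suc k) - z k)" by (simp add: summable_iff_convergent)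
  then obtain l where l: "z \<longlonglongrightarrow> l"
    by (auto simp: sum_lessThan_telescope z0 convergent_def)
  have "(\<lambda>n. z (Suc n)) \<longlonglongrightarrow> (1/2) *\<^sub>R (x + l * l)"
    unfolding zS by (intro tendsto_intros l)
  then have leq: "l = (1/2) *\<^sub>R (x + l * l)"
    using LIMSEQ_Suc[OF l] LIMSEQ_unique by blast
  have "st (z n) = z n" for n
    by (induction n) (simp_all add: z0 zS st_scaleR st_add st_mult sa)
  then have stl: "st l = l"
    using bounded_linear.tendsto[OF bounded_linear_st l] l LIMSEQ_unique by fastforce
  have nl: "norm l \<le> 1"
    by (rule LIMSEQ_le_const2[OF tendsto_norm[OF l]]) (use nz t_bounds order_trans in blast)
  \<comment> \<open>The iterates are polynomials in \<open>x\<close>, so the limit commutes with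
    whatever commutes with \<open>x\<close>.\<close>
  have comm: "y * l = l * y" if y: "y * x = x * y" for y
  proof -
    have "y * z n = z n * y" for n
    proof (induction n)
      case (Suc n)
      have "y * (z n * z n) = (z n * z n) * y" by (metis Suc mult.assoc)
      then show ?case by (simp add: zS y distrib_left distrib_right)
    qed (simp add: z0)
    moreover have "(\<lambda>n. y * z n) \<longlonglongrightarrow> y * l" "(\<lambda>n. z n * y) \<longlonglongrightarrow> l * y" by (intro tendsto_intros l)+
    ultimately show ?thesis using LIMSEQ_unique by fastforce
  qed
  have l2: "l + l = x + l * l" using arg_cong[OF leq, of "\<lambda>u. 2 *\<^sub>R u"] by (simp add: scaleR_2)
  have "(1 - l) * (1 - l) = 1 - (l + l) + l * l" by (simp add: algebra_simps)
  also have "\<dots> = 1 - x" by (simp add: l2)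
  finally have "(1 - l) * (1 - l) = 1 - x" .
  then show ?thesis
    by (rule that) (use nl stl comm in \<open>auto simp: st_diff algebra_simps\<close>)
qed

text \<open>\<open>y + i s\<close> is unitary, and \<open>y\<close>, \<open>s\<close> are its real and imaginary part.\<close>

lemma norm_le_one_if_squares_sum_one:
  assumes "st y = y" "st s = s" "y * s = s * y" "y * y + s * s = 1"
  shows "norm y \<le> 1" "norm s \<le> 1"
proof -
  define u where "u = y + sc \<i> s"
  have ii: "sc \<i> (sc \<i> w) = - w" for w
    using sc_mult[of \<i> \<i> w] sc_of_real[of "-1" w] by simp
  have mi: "sc (- \<i>) w = - sc \<i> w" for w
    using sc_mult[of "-1" \<i> w] sc_of_real[of "-1" "sc \<i> w"] by simp
  have stu: "st (y + sc \<i> s) = y - sc \<i> s" by (simp add: st_add st_sc assms mi)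
  have "st u * u = y * y + sc \<i> (y * s) - sc \<i> (s * y) - sc \<i> (sc \<i> (s * s))"
    unfolding u_def stu by (simp add: algebra_simps sc_mult_left sc_mult_right sc_add_right sc_diff_right)
  also have "\<dots> = 1" using assms by (simp add: ii)
  finally have "(norm u)\<^sup>2 = 1" using norm_st_mult_self[of u] by simp
  then have nu: "norm u = 1" using power2_eq_imp_eq[of "norm u" 1] by simp
  have "u + st u = 2 *\<^sub>R y" by (simp add: stu u_def scaleR_2)
  with norm_triangle_ineq[of u "st u"] nu show "norm y \<le> 1" by simp
  have "u - st u = sc \<i> (2 *\<^sub>R s)" by (simp add: stu u_def scaleR_2 sc_add_right)
  with norm_triangle_ineq4[of u "st u"] nu show "norm s \<le> 1" by (simp add: norm_sc)
qed

text \<open>The root s of 1 - y^2 commutes with y, so y^2 + s^2 = 1 bounds s, and the norm of s^2 is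
  the square of that of s. This is what provides a modulus: for a self-adjoint contraction k, a root
  of k^2 can be taken as a root of 1 - (1 - k^2).\<close>

lemma norm_one_minus_square_le:
  assumes "st y = y" "norm y \<le> 1"
  shows "norm (1 - y * y) \<le> 1"
proof -
  have "norm (y * y) \<le> 1" using norm_mult_ineq[of y y] assms(2) by (smt (verit) mult_le_one norm_ge_zero)
  moreover have "st (y * y) = y * y" by (simp add: st_mult assms)
  ultimately obtain s where s: "s * s = 1 - y * y" "st s = s"
    "\<And>w. w * (y * y) = (y * y) * w \<Longrightarrow> w * s = s * w" using exists_sqrt_one_minus by blast
  have "norm s \<le> 1"
    by (rule norm_le_one_if_squares_sum_one(2)[of y]) (use s assms in \<open>auto simp: mult.assoc\<close>)
  then show ?thesis using norm_st_mult_self[of s] s(1,2) by (simp add: power_le_one)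
qed

end

section \<open>Adjoints\<close>

lemma bounded_linear_blinfun_compose_left: "bounded_linear (\<lambda>T. T o\<^sub>L S)"
  and bounded_linear_blinfun_compose_right: "bounded_linear (\<lambda>S. T o\<^sub>L S)"
  by (rule bounded_bilinear.bounded_linear_left[OF bounded_bilinear_blinfun_compose],
      rule bounded_bilinear.bounded_linear_right[OF bounded_bilinear_blinfun_compose])

lemma blinfun_compose_assoc: "(T o\<^sub>L S) o\<^sub>L Q = T o\<^sub>L (S o\<^sub>L Q)"
  by (auto intro: blinfun_eqI)

lemma blinfun_compose_id [simp]: "T o\<^sub>L id_blinfun = T" "id_blinfun o\<^sub>L T = T"
  by (auto intro: blinfun_eqI)

locale hilb =
  fixes sch :: "complex \<Rightarrow> 'h::banach \<Rightarrow> 'h" and ip :: "'h \<Rightarrow> 'h \<Rightarrow> complex"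
  assumes hilbert: "hilbert_space sch ip"
begin

lemma sch_add_left: "sch (c + d) u = sch c u + sch d u"
  and sch_add_right: "sch c (u + v) = sch c u + sch c v"
  and sch_mult: "sch (c * d) u = sch c (sch d u)"
  and sch_of_real: "sch (complex_of_real r) u = r *\<^sub>R u"
  and ip_sch_left: "ip (sch c u) w = c * ip u w"
  and ip_cnj: "ip u v = cnj (ip v u)"
  and norm_ip: "norm u = sqrt (Re (ip u u))"
  using hilbert unfolding hilbert_space_def complex_action_def by metis+

lemma ip_add_left: "ip (u + v) w = ip u w + ip v w"
  using hilbert unfolding hilbert_space_def by metis

lemma ip_sch_right: "ip u (sch c w) = cnj c * ip u w"
  using ip_sch_left ip_cnj by (metis complex_cnj_mult)

text \<open>Operators of type \<open>'h \<Rightarrow>\<^sub>L 'h\<close> are only real-linear, so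
  duality is carried out for this real inner product, which induces the same norm.
  \<open>adjoint_eq_adj\<close> returns to the complex adjoint.\<close>

definition R :: "'h \<Rightarrow> 'h \<Rightarrow> real" where "R u v = Re (ip u v)"

lemma R_sym: "R u v = R v u"
  using ip_cnj[of u v] by (simp add: R_def)

lemma R_add_left: "R (u + v) w = R u w + R v w"
  by (simp add: R_def ip_add_left)

lemma R_add_right: "R w (u + v) = R w u + R w v"
  using R_add_left R_sym by metis

lemma R_scaleR_left: "R (r *\<^sub>R u) v = r * R u v"
  using ip_sch_left[of "complex_of_real r" u v] by (simp add: R_def sch_of_real)

lemma R_scaleR_right: "R v (r *\<^sub>R u) = r * R v u"
  using R_scaleR_left R_sym by metis

lemma R_minus_left: "R (- u) v = - R u v"
  using R_scaleR_left[of "-1"] by simp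

lemma R_diff_left: "R (u - v) w = R u w - R v w"
  using R_add_left[of u "- v" w] by (simp add: R_minus_left)

lemma R_diff_right: "R w (u - v) = R w u - R w v"
  using R_diff_left R_sym by metis

lemma R_zero [simp]: "R 0 v = 0" "R v 0 = 0"
  using R_scaleR_left[of 0 0] R_scaleR_right[of v 0 0] by auto

lemma R_self: "R u u = (norm u)\<^sup>2"
proof -
  have "0 \<le> sqrt (R u u)" by (simp add: R_def flip: norm_ip)
  then show ?thesis using norm_ip[of u] by (simp add: R_def)
qed

lemma R_le: "R u v \<le> norm u * norm v"
proof -
  have "(norm (u + v))\<^sup>2 \<le> (norm u + norm v)\<^sup>2"
    by (simp add: norm_triangle_ineq)
  moreover have "(norm (u + v))\<^sup>2 = (norm u)\<^sup>2 + 2 * R u v + (norm v)\<^sup>2"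
    using R_sym[of v u] by (simp add: R_add_left R_add_right flip: R_self)
  ultimately show ?thesis by (simp add: power2_sum)
qed

lemma R_eqI:
  assumes "\<And>v. R v u = R v w"
  shows "u = w"
proof -
  have "R (u - w) (u - w) = 0" using assms[of "u - w"] by (simp add: R_diff_right)
  then show ?thesis by (simp add: R_self)
qed

text \<open>The representing vector minimises \<open>\<parallel>v\<parallel>\<^sup>2 - 2 f v\<close>; minimising sequences are Cauchy by the
  parallelogram law.\<close>

lemma riesz_representation:
  fixes f :: "'h \<Rightarrow> real"
  assumes f: "bounded_linear f"
  shows "\<exists>w. \<forall>v. f v = R v w"
proof -
  interpret f: bounded_linear f by (rule f)
  define J where "J v = (norm v)\<^sup>2 - 2 * f v" for v
  obtain K where K: "\<And>v. norm (f v) \<le> norm v * K" using f.bounded by blast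
  have J_lower: "- K\<^sup>2 \<le> J v" for v
  proof -
    have "f v \<le> norm v * K" using K[of v] by simp
    moreover have "0 \<le> (norm v - K)\<^sup>2" by simp
    ultimately show ?thesis by (simp add: J_def power2_diff)
  qed
  define m where "m = Inf (range J)"
  have bdd: "bdd_below (range J)" by (rule bdd_belowI2[of _ "- K\<^sup>2"]) (rule J_lower)
  have m_le: "m \<le> J v" for v unfolding m_def by (rule cINF_lower[OF bdd]) simp
  have "\<exists>v. J v < m + 1 / real (Suc n)" for n
    using cInf_lessD[of "range J" "m + 1 / real (Suc n)"] by (auto simp: m_def)
  then obtain x where x: "\<And>n. J (x n) < m + 1 / real (Suc n)" by metis
  have para: "(norm (u - v))\<^sup>2 \<le> 2 * (J u - m) + 2 * (J v - m)" for u v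
  proof -
    define q where "q = J ((1/2) *\<^sub>R (u + v))"
    have "(norm (u - v))\<^sup>2 = 2 * J u + 2 * J v - 4 * q"
      unfolding q_def J_def f.scaleR f.add R_self[symmetric] R_scaleR_left R_scaleR_right
      by (simp add: R_add_left R_add_right R_diff_left R_diff_right R_sym[of v u] algebra_simps)
    moreover have "m \<le> q" unfolding q_def by (rule m_le)
    ultimately show ?thesis by simp
  qed
  have "Cauchy x"
  proof (rule metric_CauchyI)
    fix e :: real assume e: "0 < e"
    then obtain N where N: "1 / real (Suc N) < e\<^sup>2 / 4"
      using nat_approx_posE[of "e\<^sup>2 / 4"] by (metis zero_less_divide_iff zero_less_numeral zero_less_power)
    have "dist (x i) (x j) < e" if "N \<le> i" "N \<le> j" for i j
    proof -
      have small: "J (x k) - m < e\<^sup>2 / 4" if "N \<le> k" for k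
      proof -
        have "1 / real (Suc k) \<le> 1 / real (Suc N)" using that by (simp add: frac_le)
        then show ?thesis using x[of k] N by linarith
      qed
      have "(norm (x i - x j))\<^sup>2 < e\<^sup>2"
        using para[of "x i" "x j"] small[OF that(1)] small[OF that(2)] by argo
      then show ?thesis using e by (simp add: dist_norm power_less_imp_less_base)
    qed
    then show "\<exists>M. \<forall>m\<ge>M. \<forall>n\<ge>M. dist (x m) (x n) < e" by blast
  qed
  then obtain w where w: "x \<longlonglongrightarrow> w" using Cauchy_convergent convergent_def by blast
  have "(\<lambda>n. J (x n)) \<longlonglongrightarrow> J w" unfolding J_def by (intro tendsto_intros f.tendsto w)
  moreover have "(\<lambda>n. m + 1 / real (Suc n)) \<longlonglongrightarrow> m + 0"
    by (intro tendsto_intros LIMSEQ_Suc[OF lim_1_over_n])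
  ultimately have Jw: "J w \<le> m"
    using LIMSEQ_le x less_imp_le by (metis (no_types, lifting) add.right_neutral)
  have "f v = R v w" for v
  proof -
    define d where "d = R v w - f v"
    define N where "N = (norm v)\<^sup>2"
    \<comment> \<open>The quadratic t^2 N + 2 t d is least at t = -d / N. The denominator N + 1
      avoids the case N = 0 and still gives a negative value unless d = 0.\<close>
    define t where "t = - d / (N + 1)"
    have N: "0 \<le> N" by (simp add: N_def)
    have "J w \<le> J (w + t *\<^sub>R v)" using Jw m_le order_trans by blast
    also have "J (w + t *\<^sub>R v) = J w + t * t * N + 2 * t * d"
      unfolding J_def N_def d_def f.add f.scaleR R_self[symmetric]
      by (simp add: R_add_left R_add_right R_scaleR_left R_scaleR_right R_sym[of w v] algebra_simps)
    finally have "0 \<le> (t * t * N + 2 * t * d) * (N + 1)\<^sup>2" using N by simp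
    moreover have tN: "t * (N + 1) = - d" using N by (simp add: t_def)
    have "(t * t * N + 2 * t * d) * (N + 1)\<^sup>2
        = (t * (N + 1)) * (t * (N + 1)) * N + 2 * (t * (N + 1)) * d * (N + 1)"
      by (simp add: power2_eq_square algebra_simps)
    then have "(t * t * N + 2 * t * d) * (N + 1)\<^sup>2 = - (d\<^sup>2 * (N + 2))"
      unfolding tN by (simp add: power2_eq_square algebra_simps)
    ultimately have "d\<^sup>2 * (N + 2) \<le> 0" by simp
    then have "d\<^sup>2 \<le> 0" using N by (simp add: mult_le_0_iff)
    then show ?thesis by (simp add: d_def)
  qed
  then show ?thesis by blast
qed

lemma adjoint_blinfun_exists:
  fixes T :: "'h \<Rightarrow>\<^sub>L 'h"
  shows "\<exists>!S :: 'h \<Rightarrow>\<^sub>L 'h. \<forall>v w. R (T v) w = R v (S w)"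
proof -
  have "\<exists>s. \<forall>v. R (T v) w = R v s" for w
  proof (rule riesz_representation)
    show "bounded_linear (\<lambda>v. R (T v) w)"
    proof (rule bounded_linear_intro[where K = "norm T * norm w"])
      fix v
      have le: "R (T u) w \<le> norm u * (norm T * norm w)" for u
        using order_trans[OF R_le mult_right_mono[OF norm_blinfun norm_ge_zero]]
        by (simp add: ac_simps)
      show "norm (R (T v) w) \<le> norm v * (norm T * norm w)"
        using le[of v] le[of "- v"] by (simp add: blinfun.minus_right R_minus_left)
    qed (simp_all add: blinfun.add_right blinfun.scaleR_right R_add_left R_scaleR_left)
  qed
  then obtain S where S: "\<And>v w. R (T v) w = R v (S w)" by metis
  have "bounded_linear S"
  proof (rule bounded_linear_intro[where K = "norm T"])
    show "S (u + w) = S u + S w" for u w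
      by (rule R_eqI) (simp add: R_add_right flip: S)
    show "S (r *\<^sub>R w) = r *\<^sub>R S w" for r w
      by (rule R_eqI) (simp add: R_scaleR_right flip: S)
    show "norm (S w) \<le> norm w * norm T" for w
    proof (cases "S w = 0")
      case False
      have "norm (S w) * norm (S w) = R (T (S w)) w" by (simp add: S R_self power2_eq_square)
      also have "\<dots> \<le> norm (T (S w)) * norm w" by (rule R_le)
      also have "\<dots> \<le> norm T * norm (S w) * norm w" by (intro mult_right_mono norm_blinfun) simp
      finally show ?thesis using False by (simp add: ac_simps)
    qed (simp)
  qed
  then have "\<forall>v w. R (T v) w = R v (Blinfun S w)" by (simp add: S bounded_linear_Blinfun_apply)
  then show ?thesis
  proof (rule ex1I)
    fix S' :: "'h \<Rightarrow>\<^sub>L 'h" assume "\<forall>v w. R (T v) w = R v (S' w)"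
    then show "S' = Blinfun S"
      using S \<open>bounded_linear S\<close> by (auto intro!: blinfun_eqI R_eqI simp: bounded_linear_Blinfun_apply)
  qed
qed

definition adj :: "('h \<Rightarrow>\<^sub>L 'h) \<Rightarrow> ('h \<Rightarrow>\<^sub>L 'h)" where
  "adj T = (THE S :: 'h \<Rightarrow>\<^sub>L 'h. \<forall>v w. R (T v) w = R v (S w))"

lemma R_adj:
  fixes T :: "'h \<Rightarrow>\<^sub>L 'h"
  shows "R (T v) w = R v (adj T w)"
  using theI'[OF adjoint_blinfun_exists[of T]] unfolding adj_def by blast

lemma R_adj_left:
  fixes T :: "'h \<Rightarrow>\<^sub>L 'h"
  shows "R (adj T v) w = R v (T w)"
  using R_adj R_sym by metis

lemma adj_eqI:
  fixes T S :: "'h \<Rightarrow>\<^sub>L 'h"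
  assumes "\<And>v w. R (T v) w = R v (S w)"
  shows "adj T = S"
  using adjoint_blinfun_exists[of T] R_adj[of T] assms by blast

lemma adj_adj [simp]: "adj (adj T) = T"
  by (rule adj_eqI) (simp add: R_adj_left)

lemma adj_compose: "adj (T o\<^sub>L S) = adj S o\<^sub>L adj T"
  by (rule adj_eqI) (simp add: R_adj)

lemma adj_id [simp]: "adj id_blinfun = id_blinfun"
  by (rule adj_eqI) simp

lemma adj_add: "adj (T + S) = adj T + adj S"
  by (rule adj_eqI) (simp add: blinfun.add_left R_add_left R_add_right R_adj)

lemma adj_diff: "adj (T - S) = adj T - adj S"
  by (rule adj_eqI) (simp add: blinfun.diff_left R_diff_left R_diff_right R_adj)

lemma adj_scaleR: "adj (r *\<^sub>R T) = r *\<^sub>R adj T"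
  by (rule adj_eqI) (simp add: blinfun.scaleR_left R_scaleR_left R_scaleR_right R_adj)

lemma norm_apply_sq:
  fixes T :: "'h \<Rightarrow>\<^sub>L 'h"
  shows "(norm (T v))\<^sup>2 = R v ((adj T o\<^sub>L T) v)"
  by (simp add: R_adj flip: R_self)

lemma norm_sq_le_adj_compose_self: "(norm T)\<^sup>2 \<le> norm (adj T o\<^sub>L T)"
proof -
  have "norm T \<le> sqrt (norm (adj T o\<^sub>L T))"
  proof (rule norm_blinfun_bound)
    fix v
    have "(norm (T v))\<^sup>2 \<le> norm v * norm ((adj T o\<^sub>L T) v)" unfolding norm_apply_sq by (rule R_le)
    also have "\<dots> \<le> norm v * (norm (adj T o\<^sub>L T) * norm v)"
      by (intro mult_left_mono norm_blinfun) simp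
    also have "\<dots> = (sqrt (norm (adj T o\<^sub>L T)) * norm v)\<^sup>2"
      by (simp add: power_mult_distrib power2_eq_square)
    finally show "norm (T v) \<le> sqrt (norm (adj T o\<^sub>L T)) * norm v"
      by (rule power2_le_imp_le) simp
  qed simp
  then show ?thesis using power_mono[of "norm T" "sqrt (norm (adj T o\<^sub>L T))" 2] by simp
qed

lemma norm_adj [simp]: "norm (adj T) = norm T"
proof -
  have "norm S \<le> norm (adj S)" for S
  proof (cases "S = 0")
    case False
    have "norm S * norm S \<le> norm (adj S) * norm S"
      using norm_sq_le_adj_compose_self[of S] norm_blinfun_compose[of "adj S" S]
      by (simp add: power2_eq_square)
    with False show ?thesis by simp
  qed auto
  from this[of T] this[of "adj T"] show ?thesis by simp
qed

lemma norm_adj_compose_self: "norm (adj T o\<^sub>L T) = (norm T)\<^sup>2"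
  using norm_sq_le_adj_compose_self[of T] norm_blinfun_compose[of "adj T" T]
  by (simp add: power2_eq_square)

lemma bounded_linear_adj: "bounded_linear adj"
  by (rule bounded_linear_intro[where K = 1]) (simp_all add: adj_add adj_scaleR)

lemma adjoint_eq_adj:
  assumes "bounded_op sch T"
  shows "adjoint ip T = adj (Blinfun T)"
proof -
  have T: "bounded_linear T" and Tc: "\<And>c v. T (sch c v) = sch c (T v)"
    using assms by (auto simp: bounded_op_def)
  have B: "blinfun_apply (Blinfun T) = T" using T by (rule bounded_linear_Blinfun_apply)
  have Re_eq: "Re (ip (T v) w) = Re (ip v (adj (Blinfun T) w))" for v w
    using R_adj[of "Blinfun T" v w] by (simp add: R_def B)
  \<comment> \<open>\<open>R\<close> controls real parts only; the imaginary part is the real part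
    taken at -i v.\<close>
  have "ip (T v) w = ip v (adj (Blinfun T) w)" for v w
    using Re_eq[of v w] Re_eq[of "sch (- \<i>) v" w]
    by (intro complex_eqI) (simp_all add: Tc ip_sch_left)
  then show ?thesis unfolding adjoint_def
  proof (intro the_equality ext allI)
    fix S w assume S: "\<forall>v w. ip (T v) w = ip v (S w)"
    show "S w = adj (Blinfun T) w"
      by (rule R_eqI) (use S Re_eq in \<open>metis R_def\<close>)
  qed
qed

lemma norm_sch: "norm (sch c u) = cmod c * norm u"
proof -
  have "R (sch c u) (sch c u) = (cmod c)\<^sup>2 * R u u"
    unfolding R_def ip_sch_left ip_sch_right cmod_power2
    by (simp add: algebra_simps power2_eq_square)
  then show ?thesis by (simp add: R_self flip: power_mult_distrib)
qed

text \<open>Complex scalars become operators composed from the left, since the vector space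
  structure of \<open>'h \<Rightarrow>\<^sub>L 'h\<close> is real.\<close>

definition scal :: "complex \<Rightarrow> 'h \<Rightarrow>\<^sub>L 'h" where "scal c = Blinfun (sch c)"

lemma scal_apply [simp]: "scal c v = sch c v"
proof -
  have "sch c (r *\<^sub>R u) = r *\<^sub>R sch c u" for r u
    by (metis mult.commute sch_mult sch_of_real)
  then have "bounded_linear (sch c)"
    by (intro bounded_linear_intro[where K = "cmod c"]) (simp_all add: sch_add_right norm_sch)
  then show ?thesis by (simp add: scal_def bounded_linear_Blinfun_apply)
qed

lemma scal_mult: "scal (c * d) = scal c o\<^sub>L scal d"
  and scal_add: "scal (c + d) = scal c + scal d"
  and scal_of_real: "scal (complex_of_real r) = r *\<^sub>R id_blinfun"
  by (auto intro!: blinfun_eqI simp: sch_mult sch_add_left sch_of_real blinfun.add_left blinfun.scaleR_left)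

lemma scal_one [simp]: "scal 1 = id_blinfun"
  using scal_of_real[of 1] by simp

lemma adj_scal: "adj (scal c) = scal (cnj c)"
  by (rule adj_eqI) (simp add: R_def ip_sch_left ip_sch_right)

lemma norm_scal_compose: "norm (scal c o\<^sub>L T) = cmod c * norm T"
proof -
  have le: "norm (scal d o\<^sub>L S) \<le> cmod d * norm S" for d and S :: "'b::real_normed_vector \<Rightarrow>\<^sub>L 'h"
    by (rule norm_blinfun_bound) (simp_all add: norm_sch mult.assoc mult_left_mono norm_blinfun)
  show ?thesis
  proof (cases "c = 0")
    case False
    have "norm (scal (1 / c) o\<^sub>L (scal c o\<^sub>L T)) = norm T"
      using False by (simp add: blinfun_compose_assoc[symmetric] flip: scal_mult)
    with le[of "1 / c" "scal c o\<^sub>L T"] have "cmod c * norm T \<le> norm (scal c o\<^sub>L T)"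
      using False by (simp add: norm_divide field_simps)
    with le[of c T] show ?thesis by simp
  qed (use le[of 0 T] in simp)
qed

text \<open>\<open>D = A - B\<close> satisfies \<open>D (A + B) D = 0\<close>, hence \<open>D A D = D B D = 0\<close> by positivity and \<open>D\<^sup>3 = 0\<close>.\<close>

lemma positive_sqrt_unique:
  fixes A B :: "'h \<Rightarrow>\<^sub>L 'h"
  assumes pos: "\<And>v. 0 \<le> R v (A v)" "\<And>v. 0 \<le> R v (B v)"
    and sa: "adj A = A" "adj B = B"
    and comm: "A o\<^sub>L B = B o\<^sub>L A" and sq: "A o\<^sub>L A = B o\<^sub>L B"
  shows "A = B"
proof -
  define D where "D = A - B"
  have Dsa: "adj D = D" by (simp add: D_def adj_diff sa)
  have ABc: "A (B v) = B (A v)" "A (A v) = B (B v)" for v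
    using comm sq by (metis blinfun_apply_blinfun_compose)+
  have 1: "R (D v) (A (D v)) + R (D v) (B (D v)) = 0" for v
  proof -
    have "A (D v) + B (D v) = 0"
      by (simp add: D_def blinfun.diff_left blinfun.diff_right ABc)
    then show ?thesis using R_add_right[of "D v" "A (D v)" "B (D v)"] by simp
  qed
  have 2: "R (D v) (D (D v)) = 0" for v
  proof -
    have "R (D v) (A (D v)) = 0" "R (D v) (B (D v)) = 0"
      using 1[of v] pos(1)[of "D v"] pos(2)[of "D v"] by linarith+
    then show ?thesis by (simp add: D_def blinfun.diff_left R_diff_right)
  qed
  have Dl: "R (D v) w = R v (D w)" for v w using R_adj[of D v w] by (simp add: Dsa)
  \<comment> \<open>Polarisation: D^3 is self-adjoint and its quadratic form vanishes. Afterwards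
    |D^2 v|^2 = R (D v) (D^3 v) and |D v|^2 = R v (D^2 v) bring the exponent down to 1.\<close>
  have D3: "D (D (D v)) = 0" for v
  proof (rule R_eqI)
    fix u
    have "R u (D (D (D v))) = R v (D (D (D u)))" by (metis Dl R_sym)
    moreover have "R (u + v) (D (D (D (u + v)))) = 0" "R u (D (D (D u))) = 0" "R v (D (D (D v))) = 0"
      using 2 Dl by simp_all
    ultimately show "R u (D (D (D v))) = R u 0"
      by (simp add: blinfun.add_right R_add_left R_add_right)
  qed
  have D2: "D (D v) = 0" for v
    using R_self[of "D (D v)"] Dl[of "D v" "D (D v)"] D3[of v] by simp
  have "D v = 0" for v
    using R_self[of "D v"] Dl[of "v" "D v"] D2[of v] by simp
  then show ?thesis
    by (intro blinfun_eqI) (simp add: D_def blinfun.diff_left)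
qed

end

section \<open>Covariant representations\<close>

locale fine = cstar sc st + hilb sch ip
  for sc :: "complex \<Rightarrow> 'a::{real_normed_algebra_1,banach} \<Rightarrow> 'a" and st :: "'a \<Rightarrow> 'a"
    and sch :: "complex \<Rightarrow> 'h::banach \<Rightarrow> 'h" and ip :: "'h \<Rightarrow> 'h \<Rightarrow> complex" +
  fixes \<alpha> :: "'g::linordered_ab_group_add \<Rightarrow> 'a \<Rightarrow> 'a" and L :: "'g \<Rightarrow> 'a \<Rightarrow> 'a"
    and \<pi> :: "'a \<Rightarrow> 'h \<Rightarrow> 'h" and U :: "'g \<Rightarrow> 'h \<Rightarrow> 'h"
  assumes endo: "endo_action sc st \<alpha>"
    and fine: "finely_rep sc st \<alpha> sch ip \<pi> U"
    and transfer: "complete_transfer sc st \<alpha> L"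
begin

definition P :: "'a \<Rightarrow> 'h \<Rightarrow>\<^sub>L 'h" where "P a = Blinfun (\<pi> a)"
definition V :: "'g \<Rightarrow> 'h \<Rightarrow>\<^sub>L 'h" where "V x = Blinfun (U x)"

lemma rep: "faithful_nondeg_rep sc st sch ip \<pi>"
  using fine by (simp add: finely_rep_def)

lemma bounded_op_pi: "bounded_op sch (\<pi> a)"
  using rep by (simp add: faithful_nondeg_rep_def)

lemma P_apply: "blinfun_apply (P a) = \<pi> a"
  unfolding P_def using bounded_op_pi by (simp add: bounded_op_def bounded_linear_Blinfun_apply)

lemma P_add: "P (a + b) = P a + P b"
  and P_mult: "P (a * b) = P a o\<^sub>L P b"
  and P_sc: "P (sc c a) = scal c o\<^sub>L P a"
  using rep by (auto intro!: blinfun_eqI simp: P_apply faithful_nondeg_rep_def blinfun.add_left)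

lemma P_scal: "P a o\<^sub>L scal c = scal c o\<^sub>L P a"
  using bounded_op_pi by (auto intro!: blinfun_eqI simp: P_apply bounded_op_def)

lemma P_st: "P (st a) = adj (P a)"
proof -
  have "\<pi> (st a) = adjoint ip (\<pi> a)" using rep by (simp add: faithful_nondeg_rep_def)
  then have "blinfun_apply (P (st a)) = blinfun_apply (adj (P a))"
    unfolding adjoint_eq_adj[OF bounded_op_pi] by (simp add: P_apply flip: P_def)
  then show ?thesis by (simp add: blinfun_apply_inject)
qed

lemma P_inj: "P a = P b \<Longrightarrow> a = b"
  using rep P_apply by (metis faithful_nondeg_rep_def injD)

lemma P_scaleR: "P (r *\<^sub>R a) = r *\<^sub>R P a"
  using P_sc[of "complex_of_real r" a] by (auto intro!: blinfun_eqI simp: sc_of_real scal_of_real blinfun.scaleR_left)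

lemma linear_P: "linear P"
  by (rule linearI) (simp_all add: P_add P_scaleR)

lemma P_diff: "P (a - b) = P a - P b" and P_zero [simp]: "P 0 = 0"
  and P_sum: "P (sum f A) = (\<Sum>i\<in>A. P (f i))"
  using linear_P by (simp_all add: linear_diff linear_0 linear_sum)

text \<open>The vectors fixed by \<open>P 1\<close> form a closed subspace containing every
  \<open>\<pi> a v\<close>, and by non-degeneracy these span a dense subspace.\<close>

lemma P_one [simp]: "P 1 = id_blinfun"
proof -
  let ?S = "{v. P 1 v = v}"
  have "subspace ?S" by (auto simp: subspace_def blinfun.add_right blinfun.scaleR_right)
  moreover have "\<pi> a v \<in> ?S" for a v
    using arg_cong[OF P_mult[of 1 a], of "\<lambda>T. blinfun_apply T v"] by (simp add: P_apply)
  ultimately have "span {\<pi> a v | a v. True} \<subseteq> ?S" by (intro span_minimal) auto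
  moreover have "closed ?S"
    by (intro closed_Collect_eq continuous_intros)
  ultimately have "closure (span {\<pi> a v | a v. True}) \<subseteq> ?S" by (rule closure_minimal)
  then have "\<And>v. P 1 v = v" using rep by (auto simp: faithful_nondeg_rep_def)
  then show ?thesis by (auto intro: blinfun_eqI)
qed

text \<open>For a contraction b, the root s of 1 - b^* b gives |P b v|^2 + |P s v|^2 = |v|^2; the
  general case follows by scaling.\<close>

lemma norm_P_le: "norm (P a) \<le> norm a"
proof -
  have *: "norm (P b) \<le> 1" if b: "norm b \<le> 1" for b
  proof -
    have "norm (st b * b) \<le> 1" using b by (simp add: norm_st_mult_self power_le_one)
    moreover have "st (st b * b) = st b * b" by (simp add: st_mult)
    ultimately obtain s where s: "s * s = 1 - st b * b" "st s = s"
      using exists_sqrt_one_minus by blast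
    have "(norm (P b v))\<^sup>2 \<le> (norm v)\<^sup>2" for v
    proof -
      have "(norm (P b v))\<^sup>2 + (norm (P s v))\<^sup>2 = R v ((P (st b * b) + P (s * s)) v)"
        unfolding norm_apply_sq P_st[symmetric] s(2) P_mult by (simp add: R_add_right blinfun.add_left)
      also have "\<dots> = (norm v)\<^sup>2" unfolding s(1) P_add[symmetric] by (simp add: R_self)
      finally show ?thesis by (smt (verit) zero_le_power2)
    qed
    then show ?thesis by (intro norm_blinfun_bound) (auto intro: power2_le_imp_le)
  qed
  show ?thesis
  proof (cases "a = 0")
    case False
    then have "norm (P ((1 / norm a) *\<^sub>R a)) \<le> 1" by (intro *) simp
    with False show ?thesis by (simp add: P_scaleR field_simps)
  qed simp
qed

text \<open>Let \<open>h\<close> be self-adjoint with \<open>\<parallel>P h\<parallel> \<le> 1\<close>. Then \<open>1 - h\<^sup>2\<close> and its modulus have the same image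
  under \<open>P\<close>, so by injectivity \<open>1 - h\<^sup>2\<close> is the square of some \<open>s\<close>, and \<open>h + i s\<close> is unitary.\<close>

lemma norm_P [simp]: "norm (P a) = norm a"
proof -
  have contr: "norm h \<le> 1" if sa: "st h = h" and h: "norm (P h) \<le> 1" for h
  proof -
    \<comment> \<open>The added 1 keeps \<open>r\<close> positive when h^2 = 1. Dividing by
      \<open>r\<close> makes \<open>k\<close> a contraction, as the construction of its modulus
      requires.\<close>
    define r where "r = norm (1 - h * h) + 1"
    define k where "k = (1 / r) *\<^sub>R (1 - h * h)"
    have r: "0 < r" by (simp add: r_def add_nonneg_pos)
    have ksa: "st k = k" by (simp add: k_def st_scaleR st_diff st_mult sa)
    have nk: "norm k \<le> 1"
    proof -
      have "norm k = norm (1 - h * h) / r" using r by (simp add: k_def)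
      then show ?thesis using r by (simp add: divide_le_eq) (simp add: r_def)
    qed
    have x1: "norm (1 - k * k) \<le> 1" by (rule norm_one_minus_square_le[OF ksa nk])
    have x2: "st (1 - k * k) = 1 - k * k" by (simp add: st_diff st_mult ksa)
    \<comment> \<open>\<open>m\<close> is the modulus of \<open>k\<close>, taken as the root of k^2
      = 1 - (1 - k^2).\<close>
    obtain m where m: "m * m = 1 - (1 - k * k)" "st m = m" "norm (1 - m) \<le> 1"
      "\<And>y. y * (1 - k * k) = (1 - k * k) * y \<Longrightarrow> y * m = m * y"
      using exists_sqrt_one_minus[OF x1 x2] by blast
    have m2: "m * m = k * k" using m(1) by simp
    have km: "k * m = m * k" by (rule m(4)) (simp add: algebra_simps)
    have y2: "st (1 - m) = 1 - m" by (simp add: st_diff m)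
    \<comment> \<open>A root of \<open>m\<close> itself: it witnesses that \<open>P m\<close> is
      positive, and once m = k is known it supplies the root of 1 - h^2.\<close>
    obtain s where s: "s * s = 1 - (1 - m)" "st s = s"
      "\<And>y. y * (1 - m) = (1 - m) * y \<Longrightarrow> y * s = s * y"
      using exists_sqrt_one_minus[OF m(3) y2] by blast
    have sm: "s * s = m" using s(1) by simp
    \<comment> \<open>\<open>P k\<close> is positive because \<open>P h\<close> is a contraction, so
      \<open>P m\<close> and \<open>P k\<close> are commuting positive roots of the same
      operator.\<close>
    have "P m = P k"
    proof (rule positive_sqrt_unique)
      fix v
      have "R v (P m v) = (norm (P s v))\<^sup>2"
        unfolding norm_apply_sq P_st[symmetric] s(2) P_mult[symmetric] sm ..
      then show "0 \<le> R v (P m v)" by simp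
      have "norm (P h v) \<le> norm v" using norm_blinfun[of "P h" v] h
        by (smt (verit) mult_left_le_one_le mult_nonneg_nonneg norm_ge_zero)
      then have "(norm (P h v))\<^sup>2 \<le> (norm v)\<^sup>2" by simp
      moreover have "R v (P k v) = (1 / r) * ((norm v)\<^sup>2 - (norm (P h v))\<^sup>2)"
        unfolding norm_apply_sq P_st[symmetric] sa
        by (simp add: k_def P_scaleR P_diff blinfun.scaleR_left blinfun.diff_left R_scaleR_right
            R_diff_right R_self P_mult)
      ultimately show "0 \<le> R v (P k v)" using r by simp
    qed (simp_all add: m2 km ksa m(2) flip: P_mult P_st)
    then have "m = k" by (rule P_inj)
    have hs: "h * s = s * h"
    proof (rule s(3))
      show "h * (1 - m) = (1 - m) * h" unfolding \<open>m = k\<close> k_def by (simp add: algebra_simps)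
    qed
    define q where "q = sqrt r *\<^sub>R s"
    have "q * q = 1 - h * h" using r sm \<open>m = k\<close> by (simp add: q_def k_def)
    then show ?thesis
      by (intro norm_le_one_if_squares_sum_one(1)[of h q]) (use sa hs s(2) in \<open>auto simp: q_def st_scaleR\<close>)
  qed
  have sa: "norm h \<le> norm (P h)" if sa: "st h = h" for h
  proof (cases "h = 0")
    case False
    then have "P h \<noteq> 0" using P_inj P_zero by metis
    then have n: "0 < norm (P h)" by simp
    have "norm ((1 / norm (P h)) *\<^sub>R h) \<le> 1"
      by (rule contr) (use n in \<open>simp_all add: st_scaleR sa P_scaleR\<close>)
    with n show ?thesis by (simp add: field_simps)
  qed simp
  have "(norm a)\<^sup>2 \<le> norm (P (st a * a))"
    using sa[of "st a * a"] by (simp add: norm_st_mult_self st_mult)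
  also have "\<dots> = (norm (P a))\<^sup>2" by (simp add: P_mult P_st norm_adj_compose_self)
  finally have "norm a \<le> norm (P a)" by (rule power2_le_imp_le) simp
  with norm_P_le[of a] show ?thesis by simp
qed

lemma bounded_linear_P: "bounded_linear P"
  by (rule bounded_linear_intro[where K = 1]) (simp_all add: P_add P_scaleR)

section \<open>The endomorphisms, their implementing partial isometries and the transfer
  operators\<close>

lemma star_endo: "0 \<le> x \<Longrightarrow> star_endo sc st (\<alpha> x)"
  using endo by (simp add: endo_action_def)

lemma alpha_mult: "0 \<le> x \<Longrightarrow> \<alpha> x (a * b) = \<alpha> x a * \<alpha> x b"
  and alpha_st: "0 \<le> x \<Longrightarrow> \<alpha> x (st a) = st (\<alpha> x a)"
  using star_endo[of x] by (simp_all add: star_endo_def)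

lemma alpha_plus: "0 \<le> x \<Longrightarrow> 0 \<le> y \<Longrightarrow> \<alpha> (x + y) a = \<alpha> x (\<alpha> y a)"
  and alpha_0 [simp]: "\<alpha> 0 a = a"
  using endo by (simp_all add: endo_action_def)

lemma bounded_op_U: "0 \<le> x \<Longrightarrow> bounded_op sch (U x)"
  using fine by (simp add: finely_rep_def)

lemma V_apply: "0 \<le> x \<Longrightarrow> blinfun_apply (V x) = U x"
  unfolding V_def using bounded_op_U by (simp add: bounded_op_def bounded_linear_Blinfun_apply)

lemma adjoint_U: "0 \<le> x \<Longrightarrow> adjoint ip (U x) = adj (V x)"
  unfolding V_def by (rule adjoint_eq_adj[OF bounded_op_U])

lemma V_0 [simp]: "V 0 = id_blinfun"
  using fine V_apply[of 0] by (auto intro!: blinfun_eqI simp: finely_rep_def)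

lemma V_plus: "0 \<le> x \<Longrightarrow> 0 \<le> y \<Longrightarrow> V (x + y) = V x o\<^sub>L V y"
  using fine by (auto intro!: blinfun_eqI simp: finely_rep_def V_apply)

lemma V_scal: "0 \<le> x \<Longrightarrow> V x o\<^sub>L scal c = scal c o\<^sub>L V x"
  using bounded_op_U by (auto intro!: blinfun_eqI simp: V_apply bounded_op_def)

lemma covariance:
  assumes "0 \<le> x"
  shows "\<pi> (\<alpha> x a) = U x \<circ> \<pi> a \<circ> adjoint ip (U x)"
    "adjoint ip (U x) \<circ> \<pi> a \<circ> U x \<in> range \<pi>"
    "U x \<circ> \<pi> a = \<pi> (\<alpha> x a) \<circ> U x"
  using fine assms unfolding finely_rep_def by blast+

lemma P_alpha: "0 \<le> x \<Longrightarrow> P (\<alpha> x a) = V x o\<^sub>L (P a o\<^sub>L adj (V x))"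
  using covariance(1)[of x a] by (auto intro!: blinfun_eqI simp: P_apply V_apply adjoint_U)

lemma V_P: "0 \<le> x \<Longrightarrow> V x o\<^sub>L P a = P (\<alpha> x a) o\<^sub>L V x"
  using covariance(3)[of x a] by (auto intro!: blinfun_eqI simp: P_apply V_apply fun_eq_iff)

lemma P_V_adj: "0 \<le> x \<Longrightarrow> P a o\<^sub>L adj (V x) = adj (V x) o\<^sub>L P (\<alpha> x a)"
  using arg_cong[OF V_P[of x "st a"], of adj] by (simp add: adj_compose alpha_st P_st)

lemma V_V_adj: "0 \<le> x \<Longrightarrow> V x o\<^sub>L adj (V x) = P (\<alpha> x 1)"
  using P_alpha[of x 1] by simp

lemma P_alpha_one_V: "0 \<le> x \<Longrightarrow> P (\<alpha> x 1) o\<^sub>L V x = V x"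
  using V_P[of x 1] by simp

lemma transfer_identities:
  assumes "0 \<le> x"
  shows "L x (\<alpha> x a * b) = a * L x b" "\<alpha> x (L x a) = \<alpha> x 1 * a * \<alpha> x 1"
  using transfer assms by (auto simp: complete_transfer_def)

text \<open>\<open>V\<^sup>* V\<close> is the image of a projection \<open>p\<close> with \<open>\<alpha> p = \<alpha> 1\<close>; the transfer identity
  then forces \<open>p L(a) = L(a)\<close>, which determines \<open>L(a)\<close> from \<open>\<alpha> (L a)\<close>.\<close>

lemma P_L:
  assumes x: "0 \<le> x"
  shows "P (L x a) = adj (V x) o\<^sub>L (P a o\<^sub>L V x)"
proof -
  note assoc = blinfun_compose_assoc
  have "adjoint ip (U x) \<circ> \<pi> 1 \<circ> U x \<in> range \<pi>" by (rule covariance(2)[OF x])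
  then obtain p where "\<pi> p = adjoint ip (U x) \<circ> \<pi> 1 \<circ> U x" by force
  moreover have "\<pi> 1 = (\<lambda>v. v)" using P_apply[of 1] by (simp add: id_def)
  ultimately have p: "P p = adj (V x) o\<^sub>L V x"
    by (auto intro!: blinfun_eqI simp: P_apply V_apply adjoint_U x)
  have "P (\<alpha> x p) = P (\<alpha> x 1)"
  proof -
    have "P (\<alpha> x p) = (V x o\<^sub>L adj (V x)) o\<^sub>L (V x o\<^sub>L adj (V x))"
      by (simp add: P_alpha x p assoc)
    also have "\<dots> = P (\<alpha> x 1 * \<alpha> x 1)" by (simp add: V_V_adj x P_mult)
    also have "\<alpha> x 1 * \<alpha> x 1 = \<alpha> x 1" using alpha_mult[OF x, of 1 1] by simp
    finally show ?thesis .
  qed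
  then have "\<alpha> x p = \<alpha> x 1" by (rule P_inj)
  have "p * L x a = L x (\<alpha> x p * a)" by (simp add: transfer_identities x)
  also have "\<dots> = 1 * L x a" unfolding \<open>\<alpha> x p = \<alpha> x 1\<close> by (rule transfer_identities(1)[OF x])
  finally have pL: "p * L x a = L x a" by simp
  have "P (L x a) = P p o\<^sub>L P (L x a)" by (simp only: pL flip: P_mult)
  also have "\<dots> = adj (V x) o\<^sub>L (P (\<alpha> x (L x a)) o\<^sub>L V x)"
    by (simp add: p assoc V_P x)
  also have "\<dots> = (adj (V x) o\<^sub>L P (\<alpha> x 1)) o\<^sub>L (P a o\<^sub>L (P (\<alpha> x 1) o\<^sub>L V x))"
    by (simp add: transfer_identities x P_mult assoc)
  also have "adj (V x) o\<^sub>L P (\<alpha> x 1) = adj (V x)"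
    using arg_cong[OF P_alpha_one_V[OF x], of adj] alpha_st[OF x, of 1] by (simp add: adj_compose flip: P_st)
  finally show ?thesis by (simp add: P_alpha_one_V x)
qed

text \<open>V V^* is the projection \<open>P (\<alpha> x 1)\<close>, so N =
  \<open>norm (V x)\<close> satisfies N^4 = N^2 and must be 0 or 1.\<close>

lemma norm_V_le: "0 \<le> x \<Longrightarrow> norm (V x) \<le> 1"
proof -
  assume x: "0 \<le> x"
  have "norm (V x) ^ 2 * norm (V x) ^ 2 = norm (V x o\<^sub>L adj (V x)) * norm (V x o\<^sub>L adj (V x))"
    using norm_adj_compose_self[of "adj (V x)"] by simp
  also have "\<dots> = norm (st (\<alpha> x 1) * \<alpha> x 1)"
    unfolding V_V_adj[OF x] norm_st_mult_self by (simp add: power2_eq_square)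
  also have "\<dots> = norm (P (\<alpha> x 1))" using alpha_st[OF x, of 1] alpha_mult[OF x, of 1 1] by simp
  also have "\<dots> = norm (V x) ^ 2" using norm_adj_compose_self[of "adj (V x)"] by (simp add: V_V_adj x)
  finally have "norm (V x) ^ 2 = 0 \<or> norm (V x) ^ 2 = 1" unfolding mult_cancel_right2 by blast
  then show ?thesis using power2_eq_imp_eq[of "norm (V x)" 1] by auto
qed

lemma norm_alpha_le: "0 \<le> x \<Longrightarrow> norm (\<alpha> x a) \<le> norm a"
proof -
  assume x: "0 \<le> x"
  have "norm (P (\<alpha> x a)) \<le> norm (V x) * (norm (P a) * norm (adj (V x)))"
    unfolding P_alpha[OF x]
    by (rule order_trans[OF norm_blinfun_compose mult_left_mono[OF norm_blinfun_compose]]) simp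
  also have "\<dots> \<le> 1 * (norm a * 1)"
    using norm_V_le[OF x] by (intro mult_mono) (auto)
  finally show ?thesis by simp
qed

lemma norm_L_le: "0 \<le> x \<Longrightarrow> norm (L x a) \<le> norm a"
proof -
  assume x: "0 \<le> x"
  have "norm (P (L x a)) \<le> norm (adj (V x)) * (norm (P a) * norm (V x))"
    unfolding P_L[OF x]
    by (rule order_trans[OF norm_blinfun_compose mult_left_mono[OF norm_blinfun_compose]]) simp
  also have "\<dots> \<le> 1 * (norm a * 1)"
    using norm_V_le[OF x] by (intro mult_mono) (auto)
  finally show ?thesis by simp
qed

end

lemma infsum_bounded_linear_summable:
  assumes "bounded_linear h" "f summable_on A"
  shows "infsum (\<lambda>x. h (f x)) A = h (infsum f A)"
  by (rule infsumI, rule has_sum_bounded_linear) (use assms in auto)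

lemma summable_on_prod_nonneg:
  fixes f :: "'b \<Rightarrow> real" and g :: "'c \<Rightarrow> real"
  assumes "f summable_on A" "g summable_on B" "\<And>x. 0 \<le> f x" "\<And>y. 0 \<le> g y"
  shows "(\<lambda>(x, y). f x * g y) summable_on A \<times> B"
proof -
  have "(\<lambda>z. norm (case z of (x, y) \<Rightarrow> f x * g y)) summable_on A \<times> B"
    unfolding Infinite_Sum.abs_summable_on_Sigma_iff
    using assms by (auto simp: abs_mult infsum_cmult_right' intro!: summable_on_cmult_right summable_on_cmult_left)
  then show ?thesis by (rule abs_summable_summable)
qed

section \<open>Monomials and their products\<close>

context fine
begin

text \<open>The operator representing \<open>c u\<^sub>g\<close> for \<open>g \<ge> 0\<close> and \<open>u\<^sub>-\<^sub>g\<^sup>* c\<close> for \<open>g < 0\<close>.\<close>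

definition B :: "'g \<Rightarrow> 'a \<Rightarrow> 'h \<Rightarrow>\<^sub>L 'h" where
  "B g c = (if 0 \<le> g then P c o\<^sub>L V g else adj (V (- g)) o\<^sub>L P c)"

lemma B_nonneg: "0 \<le> g \<Longrightarrow> B g c = P c o\<^sub>L V g"
  by (simp add: B_def)

lemma B_nonpos: "g \<le> 0 \<Longrightarrow> B g c = adj (V (- g)) o\<^sub>L P c"
  by (cases "g = 0") (auto simp: B_def)

lemma B_zero_index [simp]: "B 0 c = P c"
  by (simp add: B_def)

lemma norm_B_le: "norm (B g c) \<le> norm c"
proof (cases "0 \<le> g")
  case True
  have "norm (B g c) \<le> norm (P c) * norm (V g)"
    unfolding B_nonneg[OF True] by (rule norm_blinfun_compose)
  also have "\<dots> \<le> norm c * 1" using norm_V_le[OF True] by (intro mult_mono) auto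
  finally show ?thesis by simp
next
  case False
  then have g: "g \<le> 0" by simp
  have "norm (B g c) \<le> norm (adj (V (- g))) * norm (P c)"
    unfolding B_nonpos[OF g] by (rule norm_blinfun_compose)
  also have "\<dots> \<le> 1 * norm c" using norm_V_le[of "- g"] g by (intro mult_mono) auto
  finally show ?thesis by simp
qed

lemma bounded_linear_B: "bounded_linear (B g)"
  unfolding B_def
  by (cases "0 \<le> g")
    (auto intro: bounded_linear_compose[OF bounded_linear_blinfun_compose_left bounded_linear_P]
      bounded_linear_compose[OF bounded_linear_blinfun_compose_right bounded_linear_P])

lemma B_add: "B g (a + b) = B g a + B g b" and B_zero [simp]: "B g 0 = 0"
  using bounded_linear_B[of g] by (simp_all add: linear_simps)

lemma V_adj_scal: "0 \<le> x \<Longrightarrow> adj (V x) o\<^sub>L scal c = scal c o\<^sub>L adj (V x)"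
  using arg_cong[OF V_scal[of x "cnj c"], of adj] by (simp add: adj_compose adj_scal)

lemma B_scal: "B g a o\<^sub>L scal c = scal c o\<^sub>L B g a"
  unfolding B_def
  by (cases "0 \<le> g")
    (simp_all add: blinfun_compose_assoc V_scal P_scal V_adj_scal blinfun_compose_assoc[symmetric, of _ "scal c"])

lemma B_sc: "B g (sc c a) = scal c o\<^sub>L B g a"
  unfolding B_def
  by (cases "0 \<le> g")
    (simp_all add: P_sc blinfun_compose_assoc V_adj_scal blinfun_compose_assoc[symmetric, of _ "scal c"])

lemma adj_B: "adj (B g c) = B (- g) (st c)"
proof (cases "0 \<le> g")
  case True
  then show ?thesis by (simp add: B_nonneg B_nonpos adj_compose P_st)
next
  case False
  then show ?thesis by (simp add: B_nonneg B_nonpos adj_compose P_st)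
qed

text \<open>Membership in the left ideal generated by \<open>\<alpha> g 1\<close>, or in the right
  ideal generated by \<open>\<alpha> (- g) 1\<close>. As the generators are idempotent, this is an
  equation, which passes directly to sums and limits.\<close>

definition fits :: "'g \<Rightarrow> 'a \<Rightarrow> bool" where
  "fits g c \<longleftrightarrow> (0 \<le> g \<longrightarrow> c * \<alpha> g 1 = c) \<and> (g \<le> 0 \<longrightarrow> \<alpha> (- g) 1 * c = c)"

lemma fits_zero_index [simp]: "fits 0 c"
  by (simp add: fits_def)

lemma alpha_one_idem: "0 \<le> x \<Longrightarrow> \<alpha> x 1 * \<alpha> x 1 = \<alpha> x 1"
  using alpha_mult[of x 1 1] by simp

lemma l1_set_iff: "a \<in> l1_set \<alpha> \<longleftrightarrow> (\<forall>g. fits g (a g)) \<and> (\<lambda>g. norm (a g)) summable_on UNIV"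
proof -
  have "(\<forall>x\<ge>0. (\<exists>c. a x = c * \<alpha> x 1) \<and> (\<exists>c. a (- x) = \<alpha> x 1 * c)) \<longleftrightarrow> (\<forall>g. fits g (a g))" (is "?l \<longleftrightarrow> ?r")
  proof
    assume l: ?l
    show ?r
    proof
      fix g
      show "fits g (a g)"
        unfolding fits_def
      proof (intro conjI impI)
        assume g: "0 \<le> g"
        with l obtain c where "a g = c * \<alpha> g 1" by blast
        then show "a g * \<alpha> g 1 = a g" by (simp add: mult.assoc alpha_one_idem g)
      next
        assume g: "g \<le> 0"
        with l obtain c where "a (- (- g)) = \<alpha> (- g) 1 * c" by (metis neg_0_le_iff_le)
        then show "\<alpha> (- g) 1 * a g = a g" using g by (simp add: alpha_one_idem flip: mult.assoc)
      qed
    qed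
  next
    assume r: ?r
    show ?l
    proof (intro allI impI conjI)
      fix x :: 'g assume x: "0 \<le> x"
      show "\<exists>c. a x = c * \<alpha> x 1" using r x unfolding fits_def by metis
      show "\<exists>c. a (- x) = \<alpha> x 1 * c" using r[rule_format, of "- x"] x unfolding fits_def
        by (metis minus_minus neg_le_0_iff_le)
    qed
  qed
  then show ?thesis by (simp add: l1_set_def)
qed

text \<open>A fitting coefficient absorbs the projection V V^*, so c is recovered from
  \<open>B g c\<close> by multiplying with a contraction.\<close>

lemma norm_B:
  assumes "fits g c"
  shows "norm (B g c) = norm c"
proof -
  have "norm (P c) \<le> norm (B g c)"
  proof (cases "0 \<le> g")
    case True
    have "P c = B g c o\<^sub>L adj (V g)"
      using assms True by (simp add: B_nonneg blinfun_compose_assoc V_V_adj fits_def flip: P_mult)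
    also have "norm \<dots> \<le> norm (B g c) * norm (adj (V g))" by (rule norm_blinfun_compose)
    also have "\<dots> \<le> norm (B g c) * 1" using norm_V_le[OF True] by (intro mult_left_mono) auto
    finally show ?thesis by simp
  next
    case False
    then have g: "g \<le> 0" "0 \<le> - g" by auto
    have "P c = V (- g) o\<^sub>L B g c"
      using assms g by (simp add: B_nonpos V_V_adj fits_def flip: P_mult blinfun_compose_assoc)
    also have "norm \<dots> \<le> norm (V (- g)) * norm (B g c)" by (rule norm_blinfun_compose)
    also have "\<dots> \<le> 1 * norm (B g c)" using norm_V_le[OF g(2)] by (intro mult_right_mono) auto
    finally show ?thesis by simp
  qed
  then show ?thesis using norm_B_le[of g c] by simp
qed

text \<open>The coefficient of \<open>u\<^sub>g\<^sub>+\<^sub>h\<close> in the product of the monomials with coefficients \<open>a\<close> at \<open>g\<close> and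
  \<open>b\<close> at \<open>h\<close>.\<close>

definition M :: "'g \<Rightarrow> 'g \<Rightarrow> 'a \<Rightarrow> 'a \<Rightarrow> 'a" where
  "M g h a b =
    (if 0 \<le> g \<and> 0 \<le> h then a * \<alpha> g b
     else if g \<le> 0 \<and> h \<le> 0 then \<alpha> (- h) a * b
     else if 0 < g then (if 0 \<le> g + h then a * \<alpha> (g + h) b else \<alpha> (- (g + h)) a * b)
     else (if 0 \<le> g + h then L (- g) (a * b) else L h (a * b)))"

lemma sign_cases:
  fixes g h :: 'g
  obtains (pos) "0 \<le> g" "0 \<le> h" | (neg) "g \<le> 0" "h \<le> 0" "\<not> (0 \<le> g \<and> 0 \<le> h)"
    | (pn_pos) "0 < g" "h < 0" "0 \<le> g + h" | (pn_neg) "0 < g" "h < 0" "g + h < 0"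
    | (np_pos) "g < 0" "0 < h" "0 \<le> g + h" | (np_neg) "g < 0" "0 < h" "g + h < 0"
  by (meson linorder_not_less order_less_imp_le)

lemma M_cases:
  shows "0 \<le> g \<Longrightarrow> 0 \<le> h \<Longrightarrow> M g h a b = a * \<alpha> g b"
    and "g \<le> 0 \<Longrightarrow> h \<le> 0 \<Longrightarrow> M g h a b = \<alpha> (- h) a * b"
    and "0 < g \<Longrightarrow> h < 0 \<Longrightarrow> 0 \<le> g + h \<Longrightarrow> M g h a b = a * \<alpha> (g + h) b"
    and "0 < g \<Longrightarrow> h < 0 \<Longrightarrow> g + h < 0 \<Longrightarrow> M g h a b = \<alpha> (- (g + h)) a * b"
    and "g < 0 \<Longrightarrow> 0 < h \<Longrightarrow> 0 \<le> g + h \<Longrightarrow> M g h a b = L (- g) (a * b)"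
    and "g < 0 \<Longrightarrow> 0 < h \<Longrightarrow> g + h < 0 \<Longrightarrow> M g h a b = L h (a * b)"
  by (auto simp: M_def)

lemma norm_M_le: "norm (M g h a b) \<le> norm a * norm b"
proof -
  have 1: "norm (a * \<alpha> x b) \<le> norm a * norm b" if "0 \<le> x" for x
    by (rule order_trans[OF norm_mult_ineq mult_left_mono[OF norm_alpha_le[OF that]]]) simp
  have 2: "norm (\<alpha> x a * b) \<le> norm a * norm b" if "0 \<le> x" for x
    by (rule order_trans[OF norm_mult_ineq mult_right_mono[OF norm_alpha_le[OF that]]]) simp
  have 3: "norm (L x (a * b)) \<le> norm a * norm b" if "0 \<le> x" for x
    by (rule order_trans[OF norm_L_le[OF that] norm_mult_ineq])
  show ?thesis
  proof (cases g h rule: sign_cases)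
    case pos then show ?thesis using 1[of g] by (simp add: M_cases)
  next
    case neg then show ?thesis using 2[of "- h"] by (simp add: M_cases)
  next
    case pn_pos then show ?thesis using 1[of "g + h"] by (simp add: M_cases)
  next
    case pn_neg then show ?thesis using 2[of "- (g + h)"] by (simp add: M_cases del: minus_add_distrib)
  next
    case np_pos then show ?thesis using 3[of "- g"] by (simp add: M_cases)
  next
    case np_neg then show ?thesis using 3[of h] by (simp add: M_cases)
  qed
qed

lemma M_zero [simp]: "M g h 0 b = 0" "M g h a 0 = 0"
  using norm_M_le[of g h 0 b] norm_M_le[of g h a 0] by simp_all

text \<open>The transfer action is given with this rule for factors on the left. On the right it
  holds because \<open>V x\<close> intertwines \<open>P a\<close> and
  \<open>P (\<alpha> x a)\<close>.\<close>

lemma L_mult_alpha: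
  assumes "0 \<le> x"
  shows "L x (b * \<alpha> x a) = L x b * a"
proof (rule P_inj)
  have "P (L x (b * \<alpha> x a)) = adj (V x) o\<^sub>L (P b o\<^sub>L (P (\<alpha> x a) o\<^sub>L V x))"
    using assms by (simp add: P_L P_mult blinfun_compose_assoc)
  also have "P (\<alpha> x a) o\<^sub>L V x = V x o\<^sub>L P a" using V_P[OF assms] by simp
  finally show "P (L x (b * \<alpha> x a)) = P (L x b * a)"
    using assms by (simp add: P_L P_mult blinfun_compose_assoc)
qed

text \<open>For opposite signs the larger exponent is split so that V x and its adjoint meet at the
  same x: V V^* is absorbed by a fitting coefficient, while V^* on the left and V on the right
  produce the transfer operator. For equal signs covariance suffices.\<close>

lemma B_compose:
  assumes a: "fits g a" and b: "fits h b"
  shows "B g a o\<^sub>L B h b = B (g + h) (M g h a b)"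
proof (cases g h rule: sign_cases)
  case pos
  have "B g a o\<^sub>L B h b = P a o\<^sub>L (V g o\<^sub>L P b) o\<^sub>L V h" using pos by (simp add: B_nonneg blinfun_compose_assoc)
  then show ?thesis using pos
    by (simp add: V_P B_nonneg M_cases blinfun_compose_assoc V_plus P_mult)
next
  case neg
  then have V: "V (- h + - g) = V (- h) o\<^sub>L V (- g)" by (intro V_plus) auto
  have "B g a o\<^sub>L B h b = adj (V (- g)) o\<^sub>L (P a o\<^sub>L adj (V (- h))) o\<^sub>L P b"
    using neg by (simp add: B_nonpos blinfun_compose_assoc)
  also have "\<dots> = adj (V (- h + - g)) o\<^sub>L P (\<alpha> (- h) a * b)"
    using neg unfolding V
    by (simp add: P_V_adj blinfun_compose_assoc adj_compose P_mult)
  also have "- h + - g = - (g + h)" by simp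
  finally show ?thesis using neg by (simp add: M_cases B_nonpos add_nonpos_nonpos del: minus_add_distrib)
next
  case pn_pos
  then have V: "V g = V (g + h) o\<^sub>L V (- h)" using V_plus[of "g + h" "- h"] by simp
  have "B g a o\<^sub>L B h b = P a o\<^sub>L (V (g + h) o\<^sub>L ((V (- h) o\<^sub>L adj (V (- h))) o\<^sub>L P b))"
    using pn_pos by (simp add: B_nonneg B_nonpos V blinfun_compose_assoc)
  also have "(V (- h) o\<^sub>L adj (V (- h))) o\<^sub>L P b = P b"
    using pn_pos b by (simp add: V_V_adj fits_def flip: P_mult)
  finally show ?thesis using pn_pos
    by (simp add: M_cases B_nonneg V_P P_mult blinfun_compose_assoc)
next
  case pn_neg
  then have le: "0 \<le> - (g + h)" by (metis less_imp_le neg_0_le_iff_le)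
  have V: "V (- h) = V (- (g + h)) o\<^sub>L V g" using V_plus[OF le, of g] pn_neg by simp
  have "B g a o\<^sub>L B h b = P a o\<^sub>L (V g o\<^sub>L adj (V g)) o\<^sub>L adj (V (- (g + h))) o\<^sub>L P b"
    using pn_neg by (simp add: B_nonneg B_nonpos V blinfun_compose_assoc adj_compose)
  also have "P a o\<^sub>L (V g o\<^sub>L adj (V g)) = P a"
    using pn_neg a by (simp add: V_V_adj fits_def flip: P_mult)
  also have "P a o\<^sub>L adj (V (- (g + h))) = adj (V (- (g + h))) o\<^sub>L P (\<alpha> (- (g + h)) a)"
    by (rule P_V_adj[OF le])
  finally show ?thesis using pn_neg
    by (simp add: M_cases B_nonpos P_mult blinfun_compose_assoc del: minus_add_distrib neg_0_le_iff_le)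
next
  case np_pos
  then have V: "V h = V (- g) o\<^sub>L V (g + h)" using V_plus[of "- g" "g + h"] by simp
  have "B g a o\<^sub>L B h b = (adj (V (- g)) o\<^sub>L (P (a * b) o\<^sub>L V (- g))) o\<^sub>L V (g + h)"
    using np_pos by (simp add: B_nonneg B_nonpos V blinfun_compose_assoc P_mult)
  then show ?thesis using np_pos by (simp add: M_cases B_nonneg P_L)
next
  case np_neg
  then have le: "0 \<le> - (g + h)" by (metis less_imp_le neg_0_le_iff_le)
  have V: "V (- g) = V h o\<^sub>L V (- (g + h))" using V_plus[OF _ le, of h] np_neg by simp
  have "B g a o\<^sub>L B h b = adj (V (- (g + h))) o\<^sub>L (adj (V h) o\<^sub>L (P (a * b) o\<^sub>L V h))"
    using np_neg by (simp add: B_nonneg B_nonpos V blinfun_compose_assoc P_mult adj_compose del: minus_add_distrib)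
  then show ?thesis using np_neg by (simp add: M_cases B_nonpos P_L)
qed

lemma fits_M:
  assumes a: "fits g a" and b: "fits h b"
  shows "fits (g + h) (M g h a b)"
proof -
  have fitsI: "fits k c" if "0 < k \<and> c * \<alpha> k 1 = c \<or> k < 0 \<and> \<alpha> (- k) 1 * c = c \<or> k = 0" for k c
    using that by (auto simp: fits_def)
  \<comment> \<open>At index 0 every coefficient fits, and elsewhere only the condition for one sign
    has content; \<open>fitsI\<close> exploits both.\<close>
  show ?thesis
  proof (cases "g + h = 0")
    case nz: False
    show ?thesis
    proof (cases g h rule: sign_cases)
      case pos
      then have "M g h a b * \<alpha> (g + h) 1 = a * \<alpha> g (b * \<alpha> h 1)"
        by (simp add: M_cases alpha_plus alpha_mult mult.assoc)
      then show ?thesis using pos b nz by (intro fitsI) (auto simp: M_cases fits_def order_less_le)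
    next
      case neg
      have "\<alpha> (- (g + h)) 1 * M g h a b = \<alpha> (- h) (\<alpha> (- g) 1 * a) * b"
        using neg alpha_plus[of "- h" "- g" 1] by (simp add: M_cases alpha_mult mult.assoc add.commute)
      then show ?thesis using neg a nz
        by (intro fitsI) (auto simp: M_cases fits_def add_neg_nonpos add_nonpos_neg)
    next
      case pn_pos
      then show ?thesis using nz
        by (intro fitsI) (auto simp: M_cases mult.assoc alpha_mult[symmetric])
    next
      case pn_neg
      then have le: "0 \<le> - (g + h)" by (metis less_imp_le neg_0_le_iff_le)
      with pn_neg show ?thesis
        by (intro fitsI) (auto simp: M_cases mult.assoc[symmetric] alpha_mult[symmetric] simp del: minus_add_distrib)
    next
      case np_pos
      have "M g h a b * \<alpha> (g + h) 1 = L (- g) (a * b * \<alpha> (- g) (\<alpha> (g + h) 1))"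
        using np_pos by (simp add: M_cases L_mult_alpha)
      also have "\<alpha> (- g) (\<alpha> (g + h) 1) = \<alpha> h 1" using np_pos alpha_plus[of "- g" "g + h" 1] by simp
      finally show ?thesis using np_pos b nz
        by (intro fitsI) (auto simp: M_cases fits_def mult.assoc)
    next
      case np_neg
      then have le: "0 \<le> - (g + h)" by (metis less_imp_le neg_0_le_iff_le)
      have "\<alpha> (- (g + h)) 1 * M g h a b = L h (\<alpha> h (\<alpha> (- (g + h)) 1) * (a * b))"
        using np_neg by (simp add: M_cases transfer_identities)
      also have "\<alpha> h (\<alpha> (- (g + h)) 1) = \<alpha> (- g) 1" using np_neg alpha_plus[OF _ le, of h 1] by simp
      finally show ?thesis using np_neg a
        by (intro fitsI) (auto simp: M_cases fits_def simp flip: mult.assoc)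
    qed
  qed simp
qed

end

section \<open>Characters of ordered groups\<close>

text \<open>Torsion-freeness: adding up copies of an element keeps its sign.\<close>

lemma nat_multiple_nonzero:
  fixes s :: "'g::linordered_ab_group_add" and n :: nat
  assumes "s \<noteq> 0" "0 < n"
  shows "(\<Sum>i<n. s) \<noteq> 0"
proof (cases "0 < s")
  case True
  then have "0 < (\<Sum>i<n. s)" using assms by (intro sum_pos) auto
  then show ?thesis by simp
next
  case False
  then have "0 < (\<Sum>i<n. - s)" using assms by (intro sum_pos) auto
  then show ?thesis by (simp add: sum_negf)
qed

lemma nat_multiple_add: "(\<Sum>i<m + n. s) = (\<Sum>i<m. s) + (\<Sum>i<n::nat. (s::'g::comm_monoid_add))"
  by (induction n) (simp_all add: ac_simps)

text \<open>The graph of an additive real function on a subgroup, encoded as a subgroup of the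
  product that meets the vertical axis only in 0. In this form extending means adjoining a point,
  and the union of a chain is again a graph.\<close>

definition additive_graph :: "('g::ab_group_add \<times> real) set \<Rightarrow> bool" where
  "additive_graph G \<longleftrightarrow> 0 \<in> G \<and> (\<forall>p\<in>G. \<forall>q\<in>G. p - q \<in> G) \<and> (\<forall>r. (0, r) \<in> G \<longrightarrow> r = 0)"

lemma additive_graphD:
  assumes "additive_graph G"
  shows "0 \<in> G" "p \<in> G \<Longrightarrow> q \<in> G \<Longrightarrow> p - q \<in> G" "p \<in> G \<Longrightarrow> q \<in> G \<Longrightarrow> p + q \<in> G"
    "p \<in> G \<Longrightarrow> - p \<in> G" "p \<in> G \<Longrightarrow> (\<Sum>i<n::nat. p) \<in> G" "(0, r) \<in> G \<Longrightarrow> r = 0"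
proof -
  show z: "0 \<in> G" and d: "\<And>p q. p \<in> G \<Longrightarrow> q \<in> G \<Longrightarrow> p - q \<in> G" and "(0, r) \<in> G \<Longrightarrow> r = 0"
    using assms by (auto simp: additive_graph_def)
  show m: "- p \<in> G" if "p \<in> G" for p using d[OF z that] by simp
  show a: "p + q \<in> G" if "p \<in> G" "q \<in> G" for p q using d[OF that(1) m[OF that(2)]] by simp
  show "(\<Sum>i<n::nat. p) \<in> G" if "p \<in> G"
    by (induction n) (simp_all add: z a that)
qed

text \<open>The subgroup generated by \<open>G\<close> and \<open>p\<close> fails to be a graph only
  if a nonzero multiple of \<open>p\<close> differs from an element of \<open>G\<close> by a nonzero
  vertical vector. Positive multiples suffice because \<open>G\<close> is closed under
  negation.\<close>

lemma additive_graph_extend: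
  assumes G: "additive_graph G"
    and p: "\<And>k r. 0 < k \<Longrightarrow> (\<Sum>i<k::nat. p) - (0, r) \<in> G \<Longrightarrow> r = 0"
  shows "\<exists>G'. additive_graph G' \<and> G \<subseteq> G' \<and> p \<in> G'"
proof (intro exI conjI)
  note GD = additive_graphD[OF G]
  let ?N = "\<lambda>n::nat. \<Sum>i<n. p"
  \<comment> \<open>Integer multiples of \<open>p\<close> appear as differences of natural
    ones.\<close>
  define G' where "G' = {q + ?N m - ?N n | q m n. q \<in> G}"
  have G'I: "q + ?N m - ?N n \<in> G'" if "q \<in> G" for q m n using that unfolding G'_def by blast
  show "G \<subseteq> G'" using G'I[of _ 0 0] by auto
  show "p \<in> G'" using G'I[OF GD(1), of 1 0] by simp
  show "additive_graph G'"
    unfolding additive_graph_def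
  proof (intro conjI ballI allI impI)
    show "0 \<in> G'" using G'I[OF GD(1), of 0 0] by simp
    fix a b assume "a \<in> G'" "b \<in> G'"
    then obtain q m n q' m' n' where q: "q \<in> G" "q' \<in> G"
      and ab: "a = q + ?N m - ?N n" "b = q' + ?N m' - ?N n'"
      unfolding G'_def by blast
    have "a - b = (q - q') + ?N (m + n') - ?N (n + m')"
      unfolding ab nat_multiple_add by (simp add: algebra_simps)
    then show "a - b \<in> G'" using G'I[OF GD(2)[OF q]] by metis
  next
    fix r assume "(0, r) \<in> G'"
    then obtain q m n where q: "q \<in> G" and eq: "(0, r) = q + ?N m - ?N n" unfolding G'_def by blast
    consider "m = n" | k where "0 < k" "m = n + k" | k where "0 < k" "n = m + k"
      by (metis less_imp_add_positive linorder_neqE_nat)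
    then show "r = 0"
    proof cases
      case 1
      then show ?thesis using eq q GD(6) by simp
    next
      case 2
      then have "?N k - (0, r) = - q" using eq by (simp add: nat_multiple_add)
      then show ?thesis using p[OF 2(1), of r] GD(4)[OF q] by simp
    next
      case 3
      then have "q = (0, r) + ?N k" using eq by (simp add: nat_multiple_add algebra_simps)
      then have "?N k - (0, - r) = q" by (simp add: prod_eq_iff)
      then show ?thesis using p[OF 3(1), of "- r"] q by simp
    qed
  qed
qed

text \<open>Injectivity of the divisible group of reals, by Zorn's lemma: torsion-freeness permits
  starting with the value 1 at \<open>s\<close>, and a maximal graph is defined everywhere.\<close>

lemma exists_additive_functional:
  fixes s :: "'g::linordered_ab_group_add"
  assumes s: "s \<noteq> 0"
  obtains \<phi> :: "'g \<Rightarrow> real" where "\<And>x y. \<phi> (x + y) = \<phi> x + \<phi> y" "\<phi> s = 1"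
proof -
  define F where "F = {G :: ('g \<times> real) set. additive_graph G \<and> (s, 1) \<in> G}"
  have "additive_graph {0 :: 'g \<times> real}" by (auto simp: additive_graph_def zero_prod_def)
  moreover have "r = 0" if "0 < k" "(\<Sum>i<k::nat. (s, 1::real)) - (0, r) \<in> {0}" for k r
  proof -
    have "(\<Sum>i<k. s) = 0" using that(2) by (simp add: prod_eq_iff fst_sum)
    with nat_multiple_nonzero[OF s that(1)] show ?thesis by simp
  qed
  ultimately have "F \<noteq> {}" using additive_graph_extend[of "{0}" "(s, 1)"] by (auto simp: F_def)
  then have "\<exists>M\<in>F. \<forall>X\<in>F. M \<subseteq> X \<longrightarrow> X = M"
  proof (rule subset_Zorn_nonempty)
    fix C assume C: "C \<noteq> {}" "subset.chain F C"
    have ch: "X \<in> F" "X \<subseteq> Y \<or> Y \<subseteq> X" if "X \<in> C" "Y \<in> C" for X Y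
      using C(2) that by (auto simp: subset_chain_def)
    have FD: "additive_graph X" "(s, 1) \<in> X" if "X \<in> C" for X
      using ch(1)[OF that that] by (auto simp: F_def)
    obtain X where X: "X \<in> C" using C(1) by blast
    have "additive_graph (\<Union>C)"
      unfolding additive_graph_def
    proof (intro conjI ballI allI impI)
      show "0 \<in> \<Union>C" using X additive_graphD(1)[OF FD(1)[OF X]] by blast
      fix p q assume "p \<in> \<Union>C" "q \<in> \<Union>C"
      then obtain Y Z where YZ: "p \<in> Y" "q \<in> Z" "Y \<in> C" "Z \<in> C" by blast
      then obtain W where "W \<in> C" "p \<in> W" "q \<in> W" using ch(2)[of Y Z] by blast
      then show "p - q \<in> \<Union>C" using additive_graphD(2)[OF FD(1)] by blast
    next
      fix r assume "(0, r) \<in> \<Union>C"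
      then show "r = 0" using additive_graphD(6)[OF FD(1)] by blast
    qed
    then show "\<Union>C \<in> F" using X FD(2)[OF X] by (auto simp: F_def)
  qed
  then obtain M where M: "M \<in> F" and max: "\<And>X. X \<in> F \<Longrightarrow> M \<subseteq> X \<Longrightarrow> X = M" by blast
  have Mg: "additive_graph M" and sM: "(s, 1) \<in> M" using M by (auto simp: F_def)
  note MD = additive_graphD[OF Mg]
  have inM: "p \<in> M" if gen: "\<And>k r. 0 < k \<Longrightarrow> (\<Sum>i<k::nat. p) - (0, r) \<in> M \<Longrightarrow> r = 0" for p
  proof -
    obtain G' where "additive_graph G'" "M \<subseteq> G'" "p \<in> G'"
      using additive_graph_extend[OF Mg, of p] gen by blast
    then show ?thesis using max[of G'] sM by (auto simp: F_def)
  qed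
  have total: "\<exists>v. (g, v) \<in> M" for g
  proof (cases "\<exists>k r. 0 < k \<and> ((\<Sum>i<k::nat. g), r) \<in> M")
    case True
    then obtain k r where k: "0 < k" and kr: "((\<Sum>i<k::nat. g), r) \<in> M" by blast
    \<comment> \<open>Divisibility: the value r at the multiple k g forces r / k at g. Comparing l
      times (k g, r) with k times the assumed element of \<open>M\<close> leaves (0, k t).\<close>
    have "(g, r / real k) \<in> M"
    proof (rule inM)
      fix l t assume l: "0 < l" "(\<Sum>i<l::nat. (g, r / real k)) - (0, t) \<in> M"
      let ?a = "(\<Sum>i<l. ((\<Sum>i<k. g), r))" and ?b = "(\<Sum>i<k. (\<Sum>i<l. (g, r / real k)) - (0, t))"
      have "(\<Sum>i<l. \<Sum>i<k. g) = (\<Sum>i<k. \<Sum>i<l. g)" by (rule sum.swap)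
      then have "?a - ?b = (0, real k * t)"
        using k by (simp add: prod_eq_iff fst_sum snd_sum algebra_simps)
      moreover have "?a - ?b \<in> M" by (intro MD(2) MD(5) kr l)
      ultimately show "t = 0" using MD(6) k by fastforce
    qed
    then show ?thesis by blast
  next
    case False
    \<comment> \<open>No positive multiple of g lies in the domain, so any value is consistent; 0 is
      chosen.\<close>
    have "(g, 0) \<in> M"
    proof (rule inM)
      fix k r assume k: "0 < k" and "(\<Sum>i<k::nat. (g, 0::real)) - (0, r) \<in> M"
      moreover have "(\<Sum>i<k::nat. (g, 0::real)) - (0, r) = ((\<Sum>i<k::nat. g), - r)"
        by (simp add: prod_eq_iff fst_sum snd_sum)
      ultimately have "((\<Sum>i<k. g), - r) \<in> M" by simp
      with False k show "r = 0" by blast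
    qed
    then show ?thesis by blast
  qed
  then obtain \<phi> where \<phi>: "\<And>g. (g, \<phi> g) \<in> M" by metis
  have uniq: "v = \<phi> g" if "(g, v) \<in> M" for g v
    using MD(2)[OF that \<phi>[of g]] MD(6)[of "v - \<phi> g"] by simp
  show ?thesis
  proof (rule that)
    show "\<phi> (x + y) = \<phi> x + \<phi> y" for x y using uniq[of "x + y"] MD(3)[OF \<phi>[of x] \<phi>[of y]] by simp
    show "\<phi> s = 1" using uniq[OF sM] by simp
  qed
qed

text \<open>A point of the dual of the group taken with its discrete topology.\<close>

definition character :: "('g::ab_group_add \<Rightarrow> complex) \<Rightarrow> bool" where
  "character \<omega> \<longleftrightarrow> (\<forall>x y. \<omega> (x + y) = \<omega> x * \<omega> y) \<and> (\<forall>x. cmod (\<omega> x) = 1)"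

lemma character_add: "character \<omega> \<Longrightarrow> \<omega> (x + y) = \<omega> x * \<omega> y"
  and norm_character: "character \<omega> \<Longrightarrow> cmod (\<omega> x) = 1"
  by (auto simp: character_def)

lemma character_one: "character (\<lambda>_. 1)"
  by (simp add: character_def)

lemma character_mult: "character \<omega> \<Longrightarrow> character \<psi> \<Longrightarrow> character (\<lambda>x. \<omega> x * \<psi> x)"
  by (auto simp: character_def norm_mult)

lemma character_zero: "character \<omega> \<Longrightarrow> \<omega> 0 = 1"
  using character_add[of \<omega> 0 0] norm_character[of \<omega> 0] by auto

lemma character_minus: "character \<omega> \<Longrightarrow> \<omega> (- x) = cnj (\<omega> x)"
proof -
  assume c: "character \<omega>"
  have "\<omega> (- x) * \<omega> x = 1" using character_add[OF c, of "- x" x] character_zero[OF c] by simp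
  moreover have "cnj (\<omega> x) * \<omega> x = 1"
    using complex_norm_square[of "\<omega> x"] norm_character[OF c, of x] by (simp add: mult.commute)
  moreover have "\<omega> x \<noteq> 0" using norm_character[OF c, of x] by auto
  ultimately show ?thesis by (metis mult_right_cancel)
qed

lemma exists_character_minus_one:
  fixes s :: "'g::linordered_ab_group_add"
  assumes "s \<noteq> 0"
  obtains \<omega> where "character \<omega>" "\<omega> s = -1"
proof -
  obtain \<phi> :: "'g \<Rightarrow> real" where \<phi>: "\<And>x y. \<phi> (x + y) = \<phi> x + \<phi> y" "\<phi> s = 1"
    using exists_additive_functional[OF assms] by blast
  have "character (\<lambda>x. cis (pi * \<phi> x))"
    by (simp add: character_def \<phi> distrib_left cis_mult)
  then show ?thesis by (rule that) (simp add: \<phi>)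
qed

section \<open>The representations of the l1-algebra\<close>

context fine
begin

text \<open>Indexing the three sums by the position g of the left factor turns their index sets into
  a partition of the group into two rays and an interval. Summability matters: \<open>infsum\<close>
  is 0 on non-summable families, so it need not be additive over the pieces.\<close>

lemma l1_mult_eq:
  assumes s: "(\<lambda>g. M g (k - g) (a g) (b (k - g))) summable_on UNIV"
  shows "l1_mult \<alpha> L a b k = infsum (\<lambda>g. M g (k - g) (a g) (b (k - g))) UNIV"
proof -
  define f where "f = (\<lambda>g. M g (k - g) (a g) (b (k - g)))"
  have s': "f summable_on A" for A
    using summable_on_subset_banach[OF s, of A] by (simp add: f_def)
  have split: "infsum f UNIV = infsum f A1 + infsum f A2 + infsum f A3"
    if "A1 \<union> A2 \<union> A3 = UNIV" "A1 \<inter> A2 = {}" "(A1 \<union> A2) \<inter> A3 = {}" for A1 A2 A3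
    using infsum_Un_disjoint[OF s' s' that(2)] infsum_Un_disjoint[OF s' s' that(3)] that(1) by simp
  show ?thesis
  proof (cases "0 \<le> k")
    case True
    have "infsum (\<lambda>(x, y). a x * \<alpha> (x - y) (b (- y))) {(x, y). 0 < x \<and> 0 < y \<and> k = x - y} = infsum f {k<..}"
      by (rule infsum_reindex_bij_witness[of _ "\<lambda>g. (g, g - k)" fst])
        (use True in \<open>auto simp: f_def M_cases\<close>)
    moreover have "infsum (\<lambda>(x, y). L x (a (- x) * b y)) {(x, y). 0 < x \<and> 0 < y \<and> k = y - x} = infsum f {..<0}"
      by (rule infsum_reindex_bij_witness[of _ "\<lambda>g. (- g, k - g)" "\<lambda>(x, y). - x"])
        (use True in \<open>auto simp: f_def M_cases\<close>)
    moreover have "infsum (\<lambda>(x, y). a x * \<alpha> x (b y)) {(x, y). 0 \<le> x \<and> 0 \<le> y \<and> k = x + y} = infsum f {0..k}"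
      by (rule infsum_reindex_bij_witness[of _ "\<lambda>g. (g, k - g)" fst])
        (use True in \<open>auto simp: f_def M_cases\<close>)
    moreover have "infsum f UNIV = infsum f {k<..} + infsum f {..<0} + infsum f {0..k}"
      by (rule split) (use True in auto)
    ultimately show ?thesis using True unfolding f_def by (simp add: l1_mult_def)
  next
    case False
    have "infsum (\<lambda>(x, y). \<alpha> (y - x) (a x) * b (- y)) {(x, y). 0 < x \<and> 0 < y \<and> k = x - y} = infsum f {0<..}"
      by (rule infsum_reindex_bij_witness[of _ "\<lambda>g. (g, g - k)" fst])
        (use False in \<open>auto simp: f_def M_cases\<close>)
    moreover have "infsum (\<lambda>(x, y). L y (a (- x) * b y)) {(x, y). 0 < x \<and> 0 < y \<and> k = y - x} = infsum f {..<k}"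
      by (rule infsum_reindex_bij_witness[of _ "\<lambda>g. (- g, k - g)" "\<lambda>(x, y). - x"])
        (use False in \<open>auto simp: f_def M_cases\<close>)
    moreover have "infsum (\<lambda>(x, y). \<alpha> y (a (- x)) * b (- y)) {(x, y). 0 \<le> x \<and> 0 \<le> y \<and> k = - x - y} = infsum f {k..0}"
      by (rule infsum_reindex_bij_witness[of _ "\<lambda>g. (- g, g - k)" "\<lambda>(x, y). - x"])
        (use False in \<open>auto simp: f_def M_cases\<close>)
    moreover have "infsum f UNIV = infsum f {0<..} + infsum f {..<k} + infsum f {k..0}"
      by (rule split) (use False in auto)
    ultimately show ?thesis using False unfolding f_def by (simp add: l1_mult_def)
  qed
qed

lemma l1_setD:
  assumes "a \<in> l1_set \<alpha>"
  shows "fits g (a g)" "(\<lambda>g. norm (a g)) summable_on UNIV"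
  using assms by (auto simp: l1_set_iff)

lemma summable_conv:
  assumes "a \<in> l1_set \<alpha>" "b \<in> l1_set \<alpha>"
  shows "(\<lambda>(k, g). norm (a g) * norm (b (k - g))) summable_on UNIV \<times> UNIV"
proof -
  have "(\<lambda>(g, h). norm (a g) * norm (b h)) summable_on UNIV \<times> UNIV"
    by (rule summable_on_prod_nonneg) (use assms l1_setD in auto)
  then show ?thesis
    by (subst summable_on_reindex_bij_witness[of _ "\<lambda>(g, h). (g + h, g)" "\<lambda>(k, g). (g, k - g)"
          "UNIV \<times> UNIV" "\<lambda>(g, h). norm (a g) * norm (b h)"]) auto
qed

lemma M_summable:
  assumes "a \<in> l1_set \<alpha>" "b \<in> l1_set \<alpha>"
  shows "(\<lambda>g. norm (M g (k - g) (a g) (b (k - g)))) summable_on UNIV"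
    and "(\<lambda>g. M g (k - g) (a g) (b (k - g))) summable_on UNIV"
    and "(\<lambda>k. infsum (\<lambda>g. norm (M g (k - g) (a g) (b (k - g)))) UNIV) summable_on UNIV"
proof -
  let ?f = "\<lambda>(k, g). M g (k - g) (a g) (b (k - g))"
  have *: "(\<lambda>z. norm (?f z)) summable_on UNIV \<times> UNIV"
    by (rule Infinite_Sum.abs_summable_on_comparison_test'[OF summable_conv[OF assms]]) (auto intro: norm_M_le)
  then have **: "(\<lambda>(k, g). norm (M g (k - g) (a g) (b (k - g)))) summable_on UNIV \<times> UNIV"
    by (simp add: case_prod_unfold)
  show "(\<lambda>g. norm (M g (k - g) (a g) (b (k - g)))) summable_on UNIV"
    using * unfolding Infinite_Sum.abs_summable_on_Sigma_iff by simp
  then show "(\<lambda>g. M g (k - g) (a g) (b (k - g))) summable_on UNIV"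
    by (rule abs_summable_summable)
  show "(\<lambda>k. infsum (\<lambda>g. norm (M g (k - g) (a g) (b (k - g)))) UNIV) summable_on UNIV"
    using summable_on_Sigma_banach[OF **] .
qed

lemma l1_mult_infsum:
  assumes "a \<in> l1_set \<alpha>" "b \<in> l1_set \<alpha>"
  shows "l1_mult \<alpha> L a b k = infsum (\<lambda>g. M g (k - g) (a g) (b (k - g))) UNIV"
  by (rule l1_mult_eq[OF M_summable(2)[OF assms]])

lemma l1_mult_closed:
  assumes "a \<in> l1_set \<alpha>" "b \<in> l1_set \<alpha>"
  shows "l1_mult \<alpha> L a b \<in> l1_set \<alpha>"
  unfolding l1_set_iff
proof (intro conjI allI)
  fix k
  let ?f = "\<lambda>g. M g (k - g) (a g) (b (k - g))"
  have f: "fits k (?f g)" for g using fits_M[of g "a g" "k - g" "b (k - g)"] assms l1_setD(1) by simp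
  have s: "?f summable_on UNIV" by (rule M_summable(2)[OF assms])
  show "fits k (l1_mult \<alpha> L a b k)"
    unfolding fits_def l1_mult_infsum[OF assms]
  proof (intro conjI impI)
    assume "0 \<le> k"
    then have "infsum ?f UNIV = infsum (\<lambda>g. ?f g * \<alpha> k 1) UNIV" using f by (simp add: fits_def)
    then show "infsum ?f UNIV * \<alpha> k 1 = infsum ?f UNIV"
      using infsum_bounded_linear_summable[OF bounded_linear_mult_left s] by metis
  next
    assume "k \<le> 0"
    then have "infsum ?f UNIV = infsum (\<lambda>g. \<alpha> (- k) 1 * ?f g) UNIV" using f by (simp add: fits_def)
    then show "\<alpha> (- k) 1 * infsum ?f UNIV = infsum ?f UNIV"
      using infsum_bounded_linear_summable[OF bounded_linear_mult_right s] by metis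
  qed
next
  show "(\<lambda>k. norm (l1_mult \<alpha> L a b k)) summable_on UNIV"
    by (rule Infinite_Sum.abs_summable_on_comparison_test'[OF M_summable(3)[OF assms]])
       (simp add: l1_mult_infsum[OF assms] norm_infsum_bound M_summable(1)[OF assms])
qed

lemma l1_star_closed:
  assumes "a \<in> l1_set \<alpha>"
  shows "l1_star st a \<in> l1_set \<alpha>"
  unfolding l1_set_iff
proof (intro conjI allI)
  fix g
  have f: "fits (- g) (a (- g))" by (rule l1_setD(1)[OF assms])
  have 1: "st (\<alpha> x 1) = \<alpha> x 1" if "0 \<le> x" for x using alpha_st[OF that, of 1] by simp
  show "fits g (l1_star st a g)"
    unfolding fits_def l1_star_def
  proof (intro conjI impI)
    assume g: "0 \<le> g"
    then have "st (a (- g)) = st (\<alpha> g 1 * a (- g))" using f by (simp add: fits_def)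
    then show "st (a (- g)) * \<alpha> g 1 = st (a (- g))" by (simp add: st_mult 1 g)
  next
    assume g: "g \<le> 0"
    then have "st (a (- g)) = st (a (- g) * \<alpha> (- g) 1)" using f by (simp add: fits_def)
    then show "\<alpha> (- g) 1 * st (a (- g)) = st (a (- g))" using g by (simp add: st_mult 1)
  qed
next
  show "(\<lambda>g. norm (l1_star st a g)) summable_on UNIV"
    using l1_setD(2)[OF assms]
    by (subst summable_on_reindex_bij_witness[of _ uminus uminus UNIV "\<lambda>g. norm (a g)"])
       (auto simp: l1_star_def)
qed

lemma l1_star_star [simp]: "l1_star st (l1_star st a) = a"
  by (simp add: l1_star_def)

text \<open>The integrated form of the covariant pair in which \<open>U x\<close> is multiplied by
  the scalar \<open>\<omega> x\<close>.\<close>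

definition T :: "('g \<Rightarrow> complex) \<Rightarrow> ('g \<Rightarrow> 'a) \<Rightarrow> 'h \<Rightarrow>\<^sub>L 'h" where
  "T \<omega> a = infsum (\<lambda>g. scal (\<omega> g) o\<^sub>L B g (a g)) UNIV"

lemma T_summable:
  assumes "character \<omega>" "a \<in> l1_set \<alpha>"
  shows "(\<lambda>g. norm (scal (\<omega> g) o\<^sub>L B g (a g))) summable_on UNIV"
    and "(\<lambda>g. scal (\<omega> g) o\<^sub>L B g (a g)) summable_on UNIV"
proof -
  show "(\<lambda>g. norm (scal (\<omega> g) o\<^sub>L B g (a g))) summable_on UNIV"
    by (rule Infinite_Sum.abs_summable_on_comparison_test'[OF l1_setD(2)[OF assms(2)]])
       (simp add: norm_scal_compose norm_character[OF assms(1)] norm_B_le)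
  then show "(\<lambda>g. scal (\<omega> g) o\<^sub>L B g (a g)) summable_on UNIV" by (rule abs_summable_summable)
qed

lemma norm_T_le:
  assumes "character \<omega>" "a \<in> l1_set \<alpha>"
  shows "norm (T \<omega> a) \<le> l1_norm a"
proof -
  have "norm (T \<omega> a) \<le> infsum (\<lambda>g. norm (scal (\<omega> g) o\<^sub>L B g (a g))) UNIV"
    unfolding T_def by (rule norm_infsum_bound[OF T_summable(1)[OF assms]])
  also have "\<dots> \<le> l1_norm a"
    unfolding l1_norm_def by (rule infsum_mono[OF T_summable(1)[OF assms] l1_setD(2)[OF assms(2)]])
      (simp add: norm_scal_compose norm_character[OF assms(1)] norm_B_le)
  finally show ?thesis .
qed

lemma T_add:
  assumes "character \<omega>" "a \<in> l1_set \<alpha>" "b \<in> l1_set \<alpha>"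
  shows "T \<omega> (\<lambda>g. a g + b g) = T \<omega> a + T \<omega> b"
  unfolding T_def B_add bounded_bilinear.add_right[OF bounded_bilinear_blinfun_compose]
  by (rule infsum_add[OF T_summable(2) T_summable(2)]) (use assms in auto)

lemma T_sc:
  assumes "character \<omega>" "a \<in> l1_set \<alpha>"
  shows "T \<omega> (\<lambda>g. sc c (a g)) = scal c o\<^sub>L T \<omega> a"
proof -
  have "scal (\<omega> g) o\<^sub>L B g (sc c (a g)) = scal c o\<^sub>L (scal (\<omega> g) o\<^sub>L B g (a g))" for g
    unfolding B_sc blinfun_compose_assoc[symmetric] scal_mult[symmetric] by (simp add: mult.commute)
  then show ?thesis
    unfolding T_def
    using infsum_bounded_linear_summable[OF bounded_linear_blinfun_compose_right T_summable(2)[OF assms], of "scal c"] by simp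
qed

lemma T_star:
  assumes "character \<omega>" "a \<in> l1_set \<alpha>"
  shows "T \<omega> (l1_star st a) = adj (T \<omega> a)"
proof -
  have "adj (T \<omega> a) = infsum (\<lambda>g. adj (scal (\<omega> g) o\<^sub>L B g (a g))) UNIV"
    unfolding T_def by (rule infsum_bounded_linear_summable[symmetric, OF bounded_linear_adj T_summable(2)[OF assms]])
  also have "\<dots> = infsum (\<lambda>g. scal (\<omega> g) o\<^sub>L B g (l1_star st a g)) UNIV"
    by (rule infsum_reindex_bij_witness[of _ uminus uminus])
       (auto simp: adj_compose adj_scal adj_B B_scal character_minus[OF assms(1)] l1_star_def)
  finally show ?thesis by (simp add: T_def)
qed

text \<open>Multiplicativity of \<omega> makes the scalar of a product of monomials depend only on k
  = g + h; Fubini then regroups the double sum by k.\<close>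

lemma T_mult:
  assumes \<omega>: "character \<omega>" and a: "a \<in> l1_set \<alpha>" and b: "b \<in> l1_set \<alpha>"
  shows "T \<omega> (l1_mult \<alpha> L a b) = T \<omega> a o\<^sub>L T \<omega> b"
proof -
  define F where "F = (\<lambda>(a :: 'g \<Rightarrow> 'a) g. scal (\<omega> g) o\<^sub>L B g (a g))"
  have Fs: "F a summable_on UNIV" if "a \<in> l1_set \<alpha>" for a
    unfolding F_def by (rule T_summable(2)[OF \<omega> that])
  have TF: "T \<omega> a = infsum (F a) UNIV" for a by (simp add: T_def F_def)
  have FF: "F a g o\<^sub>L F b (k - g) = scal (\<omega> k) o\<^sub>L B k (M g (k - g) (a g) (b (k - g)))" for k g
  proof -
    have "F a g o\<^sub>L F b (k - g) = (scal (\<omega> g) o\<^sub>L (B g (a g) o\<^sub>L scal (\<omega> (k - g)))) o\<^sub>L B (k - g) (b (k - g))"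
      by (simp add: F_def blinfun_compose_assoc)
    also have "\<dots> = scal (\<omega> g * \<omega> (k - g)) o\<^sub>L (B g (a g) o\<^sub>L B (k - g) (b (k - g)))"
      by (simp add: B_scal scal_mult blinfun_compose_assoc)
    also have "\<omega> g * \<omega> (k - g) = \<omega> k" using character_add[OF \<omega>, of g "k - g"] by simp
    finally show ?thesis using B_compose[OF l1_setD(1)[OF a] l1_setD(1)[OF b], of g "k - g"] by simp
  qed
  have FF_summable: "(\<lambda>(g, h). F a g o\<^sub>L F b h) summable_on UNIV \<times> UNIV"
  proof (rule abs_summable_summable, rule Infinite_Sum.abs_summable_on_comparison_test')
    show "(\<lambda>(g, h). norm (F a g) * norm (F b h)) summable_on UNIV \<times> UNIV"
      unfolding F_def by (rule summable_on_prod_nonneg) (use T_summable(1)[OF \<omega>] a b in auto)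
  qed (auto intro: norm_blinfun_compose)
  have "T \<omega> a o\<^sub>L T \<omega> b = infsum (\<lambda>g. F a g o\<^sub>L T \<omega> b) UNIV"
    unfolding TF by (rule infsum_bounded_linear_summable[symmetric, OF bounded_linear_blinfun_compose_left Fs[OF a]])
  also have "\<dots> = infsum (\<lambda>g. infsum (\<lambda>h. F a g o\<^sub>L F b h) UNIV) UNIV"
    unfolding TF infsum_bounded_linear_summable[OF bounded_linear_blinfun_compose_right Fs[OF b]] ..
  also have "\<dots> = infsum (\<lambda>(g, h). F a g o\<^sub>L F b h) (UNIV \<times> UNIV)"
    by (rule infsum_Sigma'_banach[OF FF_summable])
  also have "\<dots> = infsum (\<lambda>(k, g). F a g o\<^sub>L F b (k - g)) (UNIV \<times> UNIV)"
    by (rule infsum_reindex_bij_witness[of _ "\<lambda>(k, g). (g, k - g)" "\<lambda>(g, h). (g + h, g)"]) auto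
  also have "\<dots> = infsum (\<lambda>k. infsum (\<lambda>g. F a g o\<^sub>L F b (k - g)) UNIV) UNIV"
  proof (rule infsum_Sigma'_banach[symmetric])
    show "(\<lambda>(k, g). F a g o\<^sub>L F b (k - g)) summable_on UNIV \<times> UNIV"
      using FF_summable
      by (subst summable_on_reindex_bij_witness[of _ "\<lambda>(g, h). (g + h, g)" "\<lambda>(k, g). (g, k - g)"
            "UNIV \<times> UNIV" "\<lambda>(g, h). F a g o\<^sub>L F b h"]) auto
  qed
  also have "\<dots> = infsum (\<lambda>k. scal (\<omega> k) o\<^sub>L B k (l1_mult \<alpha> L a b k)) UNIV"
    unfolding FF l1_mult_infsum[OF a b]
    by (simp add: infsum_bounded_linear_summable[OF bounded_linear_compose[OF bounded_linear_blinfun_compose_right bounded_linear_B] M_summable(2)[OF a b]])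
  finally show ?thesis by (simp add: T_def)
qed

lemma cstar_seminorm_T:
  assumes "character \<omega>"
  shows "cstar_seminorm sc st \<alpha> L (\<lambda>a. norm (T \<omega> a))"
  unfolding cstar_seminorm_def
  using assms by (auto simp: T_add T_sc T_mult T_star l1_star_closed norm_triangle_ineq norm_scal_compose
      norm_blinfun_compose norm_adj_compose_self norm_T_le)

end

section \<open>Fourier coefficients\<close>

context fine
begin

text \<open>If \<open>\<psi> (s - e) = -1\<close>, then averaging over the characters \<open>1\<close> and \<open>\<psi>\<close> removes the
  coefficient at \<open>s\<close> and keeps the one at \<open>e\<close>.\<close>

lemma norm_coefficient_le:
  fixes D :: "'g \<Rightarrow> 'h \<Rightarrow>\<^sub>L 'h"
  assumes "finite S" "e \<notin> S"
    and "\<And>\<omega>. character \<omega> \<Longrightarrow> norm (\<Sum>g\<in>insert e S. scal (\<omega> g) o\<^sub>L D g) \<le> K"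
  shows "norm (D e) \<le> K"
  using assms
proof (induction S arbitrary: D rule: finite_induct)
  case empty
  then show ?case using character_one[where 'a = 'g] by fastforce
next
  case (insert s S)
  then obtain \<psi> where \<psi>: "character \<psi>" "\<psi> (s - e) = -1"
    using exists_character_minus_one[of "s - e"] by auto
  \<comment> \<open>The factor is 1 at g = e and 0 at g = s, so the induction hypothesis applies to
    the support without s.\<close>
  define D' where "D' g = scal ((1 + \<psi> (g - e)) / 2) o\<^sub>L D g" for g
  have scal0: "scal 0 = 0" using scal_of_real[of 0] by simp
  have D'e: "D' e = D e" by (simp add: D'_def character_zero[OF \<psi>(1)])
  have "norm (D' e) \<le> K"
  proof (rule insert.IH)
    show "e \<notin> S" using insert.prems by simp
    fix \<omega> :: "'g \<Rightarrow> complex" assume \<omega>: "character \<omega>"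
    let ?A = "insert e (insert s S)"
    let ?X = "\<lambda>\<omega>. \<Sum>g\<in>?A. scal (\<omega> g) o\<^sub>L D g"
    \<comment> \<open>Twisting \<open>D'\<close> by \<omega> is the mean of twisting
      \<open>D\<close> by \<omega> and by the product of \<omega> and \<psi>, the latter rotated by
      a unimodular scalar; hence the bound \<open>K\<close> survives.\<close>
    have eq: "scal (\<omega> g) o\<^sub>L D' g
        = (1/2) *\<^sub>R ((scal (\<omega> g) o\<^sub>L D g) + (scal (cnj (\<psi> e)) o\<^sub>L (scal (\<omega> g * \<psi> g) o\<^sub>L D g)))" for g
    proof -
      have "\<psi> (g - e) = \<psi> g * cnj (\<psi> e)"
        using character_add[OF \<psi>(1), of g "- e"] by (simp add: character_minus[OF \<psi>(1)])
      then have "\<omega> g * ((1 + \<psi> (g - e)) / 2)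
          = complex_of_real (1/2) * (\<omega> g + cnj (\<psi> e) * (\<omega> g * \<psi> g))"
        by (simp add: field_simps)
      then have "scal (\<omega> g) o\<^sub>L D' g = scal (complex_of_real (1/2) * (\<omega> g + cnj (\<psi> e) * (\<omega> g * \<psi> g))) o\<^sub>L D g"
        unfolding D'_def blinfun_compose_assoc[symmetric] scal_mult[symmetric] by simp
      then show ?thesis
        unfolding scal_mult[of "complex_of_real _"] scal_add scal_of_real scal_mult[of "cnj _"]
        by (intro blinfun_eqI) (simp add: blinfun.add_left blinfun.scaleR_left)
    qed
    have "(\<Sum>g\<in>insert e S. scal (\<omega> g) o\<^sub>L D' g) = (\<Sum>g\<in>?A. scal (\<omega> g) o\<^sub>L D' g)"
      by (rule sum.mono_neutral_left) (use insert \<psi> in \<open>auto simp: D'_def scal0\<close>)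
    also have "\<dots> = (1/2) *\<^sub>R (?X \<omega> + (scal (cnj (\<psi> e)) o\<^sub>L ?X (\<lambda>g. \<omega> g * \<psi> g)))"
      unfolding eq linear_sum[OF bounded_linear.linear[OF bounded_linear_blinfun_compose_right]]
      by (simp add: scaleR_sum_right[symmetric] sum.distrib del: sum.insert)
    also have "norm \<dots> \<le> (1/2) * (K + K)"
    proof -
      have "norm (?X \<omega>) \<le> K" by (rule insert.prems(2)[OF \<omega>])
      moreover have "norm (scal (cnj (\<psi> e)) o\<^sub>L ?X (\<lambda>g. \<omega> g * \<psi> g)) \<le> K"
        unfolding norm_scal_compose
        using insert.prems(2)[OF character_mult[OF \<omega> \<psi>(1)]] norm_character[OF \<psi>(1), of e] by simp
      ultimately show ?thesis unfolding norm_scaleR using norm_triangle_mono by fastforce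
    qed
    finally show "norm (\<Sum>g\<in>insert e S. scal (\<omega> g) o\<^sub>L D' g) \<le> K" by simp
  qed
  then show ?case by (simp add: D'e)
qed

section \<open>The finitely supported subalgebra\<close>

lemma C0_setD:
  assumes "a \<in> C0_set \<alpha>"
  shows "a \<in> l1_set \<alpha>" "finite {g. a g \<noteq> 0}"
  using assms by (auto simp: C0_set_def)

lemma T_finite:
  assumes "finite F" "{g. a g \<noteq> 0} \<subseteq> F"
  shows "T \<omega> a = (\<Sum>g\<in>F. scal (\<omega> g) o\<^sub>L B g (a g))"
proof -
  have "a g = 0" if "g \<notin> F" for g using assms(2) that by blast
  then have "T \<omega> a = infsum (\<lambda>g. scal (\<omega> g) o\<^sub>L B g (a g)) F"
    unfolding T_def by (intro infsum_cong_neutral) auto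
  then show ?thesis using assms by simp
qed

text \<open>For e = 0 this bounds \<open>E0\<close>; for arbitrary e it gives the separation of
  points in \<open>C0_eqI\<close>.\<close>

lemma norm_coefficient_le_T:
  assumes a: "a \<in> C0_set \<alpha>" and K: "\<And>\<omega>. character \<omega> \<Longrightarrow> norm (T \<omega> a) \<le> K"
  shows "norm (a e) \<le> K"
proof -
  let ?S = "{g. a g \<noteq> 0} - {e}"
  have "norm (B e (a e)) \<le> K"
  proof (rule norm_coefficient_le[of ?S e "\<lambda>g. B g (a g)"])
    show "finite ?S" using C0_setD(2)[OF a] by simp
    fix \<omega> :: "'g \<Rightarrow> complex" assume \<omega>: "character \<omega>"
    have "T \<omega> a = (\<Sum>g\<in>insert e ?S. scal (\<omega> g) o\<^sub>L B g (a g))"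
      by (rule T_finite) (use C0_setD(2)[OF a] in auto)
    then show "norm (\<Sum>g\<in>insert e ?S. scal (\<omega> g) o\<^sub>L B g (a g)) \<le> K"
      using K[OF \<omega>] by (simp only:)
  qed simp
  then show ?thesis using norm_B[OF l1_setD(1)[OF C0_setD(1)[OF a]]] by simp
qed

lemma l1_set_add:
  assumes "a \<in> l1_set \<alpha>" "b \<in> l1_set \<alpha>"
  shows "(\<lambda>g. a g + b g) \<in> l1_set \<alpha>"
  unfolding l1_set_iff
proof (intro conjI allI)
  show "fits g (a g + b g)" for g
    using assms l1_setD(1)[of _ g] by (auto simp: fits_def distrib_left distrib_right)
  show "(\<lambda>g. norm (a g + b g)) summable_on UNIV"
    by (rule Infinite_Sum.abs_summable_on_comparison_test'[OF
          summable_on_add[OF l1_setD(2)[OF assms(1)] l1_setD(2)[OF assms(2)]]]) (rule norm_triangle_ineq)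
qed

lemma l1_set_sc:
  assumes "a \<in> l1_set \<alpha>"
  shows "(\<lambda>g. sc c (a g)) \<in> l1_set \<alpha>"
  using assms unfolding l1_set_iff
  by (auto simp: fits_def sc_mult_left sc_mult_right norm_sc intro: summable_on_cmult_right)

lemma C0_eqI:
  assumes a: "a \<in> C0_set \<alpha>" and b: "b \<in> C0_set \<alpha>"
    and eq: "\<And>\<omega>. character \<omega> \<Longrightarrow> T \<omega> a = T \<omega> b"
  shows "a = b"
proof
  fix e
  let ?b = "\<lambda>g. sc (-1) (b g)" and ?d = "\<lambda>g. a g + sc (-1) (b g)"
  have minus: "sc (-1) x = - x" for x using sc_of_real[of "-1" x] by simp
  have b': "?b \<in> l1_set \<alpha>" by (rule l1_set_sc[OF C0_setD(1)[OF b]])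
  have "?d \<in> l1_set \<alpha>" by (rule l1_set_add[OF C0_setD(1)[OF a] b'])
  moreover have "finite {g. ?d g \<noteq> 0}"
    by (rule finite_subset[of _ "{g. a g \<noteq> 0} \<union> {g. b g \<noteq> 0}"]) (use a b C0_setD(2) in \<open>auto simp: minus\<close>)
  ultimately have d: "?d \<in> C0_set \<alpha>" by (simp add: C0_set_def)
  have "norm (?d e) \<le> 0"
  proof (rule norm_coefficient_le_T[OF d])
    fix \<omega> :: "'g \<Rightarrow> complex" assume \<omega>: "character \<omega>"
    have "scal (-1) = - id_blinfun" using scal_of_real[of "-1"] by simp
    then have "T \<omega> ?d = T \<omega> a - T \<omega> b"
      using T_add[OF \<omega> C0_setD(1)[OF a] b'] T_sc[OF \<omega> C0_setD(1)[OF b], of "-1"]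
      by (intro blinfun_eqI) (simp add: blinfun.minus_left blinfun.add_left blinfun.diff_left)
    then show "norm (T \<omega> ?d) \<le> 0" using eq[OF \<omega>] by simp
  qed
  then show "a e = b e" by (simp add: minus)
qed

lemma l1_mult_support:
  assumes "a \<in> l1_set \<alpha>" "b \<in> l1_set \<alpha>" "l1_mult \<alpha> L a b k \<noteq> 0"
  obtains g h where "k = g + h" "a g \<noteq> 0" "b h \<noteq> 0"
proof -
  have "\<exists>g. M g (k - g) (a g) (b (k - g)) \<noteq> 0"
  proof (rule ccontr)
    assume "\<nexists>g. M g (k - g) (a g) (b (k - g)) \<noteq> 0"
    then show False using assms(3) by (simp add: l1_mult_infsum[OF assms(1,2)])
  qed
  then obtain g where "M g (k - g) (a g) (b (k - g)) \<noteq> 0" by blast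
  then have "a g \<noteq> 0" "b (k - g) \<noteq> 0" by auto
  then show ?thesis using that[of g "k - g"] by simp
qed

lemma C0_mult:
  assumes "a \<in> C0_set \<alpha>" "b \<in> C0_set \<alpha>"
  shows "l1_mult \<alpha> L a b \<in> C0_set \<alpha>"
proof -
  note ab = C0_setD(1)[OF assms(1)] C0_setD(1)[OF assms(2)]
  have "{k. l1_mult \<alpha> L a b k \<noteq> 0} \<subseteq> (\<lambda>(g, h). g + h) ` ({g. a g \<noteq> 0} \<times> {h. b h \<noteq> 0})"
  proof
    fix k assume "k \<in> {k. l1_mult \<alpha> L a b k \<noteq> 0}"
    then obtain g h where "k = g + h" "a g \<noteq> 0" "b h \<noteq> 0" using l1_mult_support[OF ab] by blast
    then show "k \<in> (\<lambda>(g, h). g + h) ` ({g. a g \<noteq> 0} \<times> {h. b h \<noteq> 0})" by auto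
  qed
  moreover have "finite ((\<lambda>(g, h). g + h) ` ({g. a g \<noteq> 0} \<times> {h. b h \<noteq> 0}))"
    using assms C0_setD(2) by auto
  ultimately show ?thesis
    using l1_mult_closed[OF ab] finite_subset by (auto simp: C0_set_def)
qed

lemma C0_star:
  assumes "a \<in> C0_set \<alpha>"
  shows "l1_star st a \<in> C0_set \<alpha>"
proof -
  have "{g. l1_star st a g \<noteq> 0} \<subseteq> uminus ` {g. a g \<noteq> 0}"
    by (auto simp: l1_star_def image_iff) (metis minus_minus st_zero)
  then show ?thesis
    using assms l1_star_closed by (auto simp: C0_set_def intro: finite_subset)
qed

lemma C0_one: "l1_one \<in> C0_set \<alpha>"
proof -
  have "(\<lambda>g. norm ((l1_one :: 'g \<Rightarrow> 'a) g)) summable_on UNIV"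
    by (rule finite_nonzero_values_imp_summable_on) (simp add: l1_one_def)
  then show ?thesis
    by (auto simp: C0_set_def l1_set_iff l1_one_def fits_def)
qed

lemma T_one: "T \<omega> l1_one = scal (\<omega> 0)"
  by (subst T_finite[of "{0}"]) (auto simp: l1_one_def)

lemma C0_assoc:
  assumes "a \<in> C0_set \<alpha>" "b \<in> C0_set \<alpha>" "c \<in> C0_set \<alpha>"
  shows "l1_mult \<alpha> L (l1_mult \<alpha> L a b) c = l1_mult \<alpha> L a (l1_mult \<alpha> L b c)"
  by (rule C0_eqI) (use assms in \<open>simp_all add: C0_mult T_mult C0_setD(1) blinfun_compose_assoc\<close>)

lemma C0_star_mult:
  assumes "a \<in> C0_set \<alpha>" "b \<in> C0_set \<alpha>"
  shows "l1_star st (l1_mult \<alpha> L a b) = l1_mult \<alpha> L (l1_star st b) (l1_star st a)"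
  by (rule C0_eqI) (use assms in \<open>simp_all add: C0_mult C0_star T_mult T_star C0_setD(1) adj_compose\<close>)

lemma C0_one_mult:
  assumes "a \<in> C0_set \<alpha>"
  shows "l1_mult \<alpha> L l1_one a = a" "l1_mult \<alpha> L a l1_one = a"
  by (rule C0_eqI; use assms in \<open>simp add: C0_mult C0_one T_mult T_one character_zero C0_setD(1)\<close>)+

lemma star_one: "l1_star st (l1_one :: 'g \<Rightarrow> 'a) = l1_one"
  by (auto simp: l1_star_def l1_one_def)

text \<open>\<open>E\<^sub>0(b b\<^sup>*)\<close> is represented by the sum of the positive operators \<open>B\<^sub>g B\<^sub>g\<^sup>*\<close>.\<close>

lemma norm_coefficient_sq_le_E0:
  assumes b: "b \<in> C0_set \<alpha>"
  shows "(norm (b e))\<^sup>2 \<le> norm (E0 (l1_mult \<alpha> L b (l1_star st b)))"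
proof (cases "b e = 0")
  case False
  let ?F = "{g. b g \<noteq> 0}" and ?x = "E0 (l1_mult \<alpha> L b (l1_star st b))"
  note bl = C0_setD(1)[OF b]
  have fin: "finite ?F" by (rule C0_setD(2)[OF b])
  have "?x = infsum (\<lambda>g. M g (0 - g) (b g) (l1_star st b (0 - g))) UNIV"
    unfolding E0_def by (rule l1_mult_infsum[OF bl l1_star_closed[OF bl]])
  also have "\<dots> = infsum (\<lambda>g. M g (0 - g) (b g) (l1_star st b (0 - g))) ?F"
    by (rule infsum_cong_neutral) auto
  also have "\<dots> = (\<Sum>g\<in>?F. M g (0 - g) (b g) (l1_star st b (0 - g)))" using fin by simp
  finally have "P ?x = (\<Sum>g\<in>?F. B (g + (0 - g)) (M g (0 - g) (b g) (l1_star st b (0 - g))))"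
    by (simp add: P_sum)
  also have "\<dots> = (\<Sum>g\<in>?F. B g (b g) o\<^sub>L adj (B g (b g)))"
  proof (rule sum.cong)
    fix g
    have "B g (b g) o\<^sub>L B (0 - g) (l1_star st b (0 - g))
        = B (g + (0 - g)) (M g (0 - g) (b g) (l1_star st b (0 - g)))"
      by (rule B_compose[OF l1_setD(1)[OF bl] l1_setD(1)[OF l1_star_closed[OF bl]]])
    then show "B (g + (0 - g)) (M g (0 - g) (b g) (l1_star st b (0 - g))) = B g (b g) o\<^sub>L adj (B g (b g))"
      by (simp add: l1_star_def adj_B)
  qed simp
  finally have Px: "P ?x = (\<Sum>g\<in>?F. B g (b g) o\<^sub>L adj (B g (b g)))" .
  have "norm (adj (B e (b e))) \<le> sqrt (norm ?x)"
  proof (rule norm_blinfun_bound)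
    fix v
    have R_sum: "R v (sum f A) = (\<Sum>g\<in>A. R v (f g))" if "finite A" for f and A :: "'g set"
      using that by (induction A rule: finite_induct) (simp_all add: R_add_right)
    have "(norm (adj (B e (b e)) v))\<^sup>2 \<le> (\<Sum>g\<in>?F. (norm (adj (B g (b g)) v))\<^sup>2)"
      using False fin by (intro member_le_sum) auto
    also have "\<dots> = R v (P ?x v)"
      unfolding Px blinfun.sum_left R_sum[OF fin] norm_apply_sq by simp
    also have "\<dots> \<le> norm v * norm (P ?x v)" by (rule R_le)
    also have "\<dots> \<le> norm v * (norm (P ?x) * norm v)" by (intro mult_left_mono norm_blinfun) simp
    also have "\<dots> = (sqrt (norm ?x) * norm v)\<^sup>2" by (simp add: power_mult_distrib power2_eq_square)
    finally show "norm (adj (B e (b e)) v) \<le> sqrt (norm ?x) * norm v" by (rule power2_le_imp_le) simp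
  qed simp
  then have "norm (b e) \<le> sqrt (norm ?x)" using norm_B[OF l1_setD(1)[OF bl]] by simp
  then show ?thesis using power_mono[of "norm (b e)" "sqrt (norm ?x)" 2] by simp
qed simp

end

section \<open>Growth of powers\<close>

text \<open>Removes the count of the support: the logarithm of a fixed power of k + 1 is negligible
  against k.\<close>

lemma tendsto_power_powr_inverse: "(\<lambda>k. (real (k + 1) ^ N) powr (1 / (2 * real k))) \<longlonglongrightarrow> 1"
proof -
  have "(\<lambda>k. ln (real (k + 1)) / (2 * real k)) \<longlonglongrightarrow> 0" by real_asymp
  then have "(\<lambda>k. exp (real N * (ln (real (k + 1)) / (2 * real k)))) \<longlonglongrightarrow> exp (real N * 0)"
    by (intro tendsto_intros)
  moreover have "(real (k + 1) ^ N) powr (1 / (2 * real k)) = exp (real N * (ln (real (k + 1)) / (2 * real k)))" for k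
    by (simp add: powr_def ln_realpow)
  ultimately show ?thesis by simp
qed

context fine
begin

lemma l1_pow_0: "l1_pow \<alpha> L h 0 = l1_one"
  and l1_pow_Suc: "l1_pow \<alpha> L h (Suc n) = l1_mult \<alpha> L h (l1_pow \<alpha> L h n)"
  by (simp_all add: l1_pow_def)

lemma C0_pow: "h \<in> C0_set \<alpha> \<Longrightarrow> l1_pow \<alpha> L h n \<in> C0_set \<alpha>"
  by (induction n) (simp_all add: l1_pow_0 l1_pow_Suc C0_one C0_mult)

lemma l1_pow_add:
  "h \<in> C0_set \<alpha> \<Longrightarrow> l1_pow \<alpha> L h (m + n) = l1_mult \<alpha> L (l1_pow \<alpha> L h m) (l1_pow \<alpha> L h n)"
  by (induction m) (simp_all add: l1_pow_0 l1_pow_Suc C0_one_mult C0_pow C0_assoc)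

lemma l1_pow_1: "h \<in> C0_set \<alpha> \<Longrightarrow> l1_pow \<alpha> L h (Suc 0) = h"
  by (simp add: l1_pow_0 l1_pow_Suc C0_one_mult)

lemma l1_pow_star:
  assumes "h \<in> C0_set \<alpha>" "l1_star st h = h"
  shows "l1_star st (l1_pow \<alpha> L h n) = l1_pow \<alpha> L h n"
proof (induction n)
  case (Suc n)
  have "l1_star st (l1_pow \<alpha> L h (Suc n)) = l1_mult \<alpha> L (l1_pow \<alpha> L h n) (l1_pow \<alpha> L h (Suc 0))"
    using Suc assms by (simp add: l1_pow_Suc[of h n] C0_star_mult C0_pow l1_pow_1)
  then show ?case using l1_pow_add[OF assms(1), of n "Suc 0"] by simp
qed (simp add: l1_pow_0 star_one)

section \<open>C*-seminorms of powers, and the supports of powers\<close>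

lemma seminormD:
  assumes "cstar_seminorm sc st \<alpha> L p" "a \<in> l1_set \<alpha>"
  shows "0 \<le> p a" "b \<in> l1_set \<alpha> \<Longrightarrow> p (l1_mult \<alpha> L a b) \<le> p a * p b"
    "p (l1_mult \<alpha> L (l1_star st a) a) = (p a)\<^sup>2" "p a \<le> l1_norm a"
  using assms unfolding cstar_seminorm_def by blast+

text \<open>The C*-identity is given for a^* a. Together with submultiplicativity it makes p
  invariant under the star, which yields the identity for a a^* as well.\<close>

lemma seminorm_mult_star:
  assumes p: "cstar_seminorm sc st \<alpha> L p" and a: "a \<in> l1_set \<alpha>"
  shows "p (l1_mult \<alpha> L a (l1_star st a)) = (p a)\<^sup>2"
proof -
  have le: "p b \<le> p (l1_star st b)" if b: "b \<in> l1_set \<alpha>" for b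
  proof (cases "p b = 0")
    case True
    then show ?thesis using seminormD(1)[OF p l1_star_closed[OF b]] by simp
  next
    case False
    have "p b * p b \<le> p (l1_star st b) * p b"
      using seminormD(3)[OF p b] seminormD(2)[OF p l1_star_closed[OF b] b] by (simp add: power2_eq_square)
    then show ?thesis using False seminormD(1)[OF p b] by simp
  qed
  have "p (l1_star st a) = p a" using le[OF a] le[OF l1_star_closed[OF a]] by simp
  then show ?thesis using seminormD(3)[OF p l1_star_closed[OF a]] by simp
qed

lemma l1_norm_one: "l1_norm (l1_one :: 'g \<Rightarrow> 'a) = 1"
proof -
  have "l1_norm (l1_one :: 'g \<Rightarrow> 'a) = infsum (\<lambda>g. norm (l1_one g :: 'a)) {0 :: 'g}"
    unfolding l1_norm_def by (rule infsum_cong_neutral) (auto simp: l1_one_def)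
  then show ?thesis by (simp add: l1_one_def)
qed

lemma seminorm_pow_le:
  assumes p: "cstar_seminorm sc st \<alpha> L p" and h: "h \<in> C0_set \<alpha>"
  shows "p (l1_pow \<alpha> L h n) \<le> p h ^ n"
proof (induction n)
  case 0
  then show ?case using seminormD(4)[OF p C0_setD(1)[OF C0_one]] by (simp add: l1_pow_0 l1_norm_one)
next
  case (Suc n)
  have "p (l1_pow \<alpha> L h (Suc n)) \<le> p h * p (l1_pow \<alpha> L h n)"
    unfolding l1_pow_Suc by (rule seminormD(2)[OF p]) (use h C0_pow C0_setD(1) in auto)
  also have "\<dots> \<le> p h * p h ^ n" using seminormD(1)[OF p C0_setD(1)[OF h]] by (intro mult_left_mono Suc)
  finally show ?case by simp
qed

text \<open>The C*-identity gives equality along powers of two. Any n is reached by writing 2^n = n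
  + (2^n - n): submultiplicativity and the upper bound for the second factor allow a cancellation.
  For n = 0 the zero seminorm is a counterexample.\<close>

lemma seminorm_pow_ge:
  assumes p: "cstar_seminorm sc st \<alpha> L p" and h: "h \<in> C0_set \<alpha>" "l1_star st h = h" and n: "0 < n"
  shows "p h ^ n \<le> p (l1_pow \<alpha> L h n)"
proof (cases "p h = 0")
  case True
  then show ?thesis using n seminormD(1)[OF p C0_setD(1)[OF C0_pow[OF h(1)]]] by (simp add: zero_power)
next
  case False
  have ph: "0 < p h" using False seminormD(1)[OF p C0_setD(1)[OF h(1)]] by simp
  have two: "p (l1_pow \<alpha> L h (2 ^ m)) = p h ^ (2 ^ m)" for m
  proof (induction m)
    case 0
    then show ?case by (simp add: l1_pow_1[OF h(1)])
  next
    case (Suc m)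
    let ?b = "l1_pow \<alpha> L h (2 ^ m)"
    have "l1_pow \<alpha> L h (2 ^ Suc m) = l1_mult \<alpha> L (l1_star st ?b) ?b"
      using l1_pow_add[OF h(1), of "2 ^ m" "2 ^ m"] by (simp add: l1_pow_star[OF h] mult_2)
    then have "p (l1_pow \<alpha> L h (2 ^ Suc m)) = (p ?b)\<^sup>2"
      using seminormD(3)[OF p C0_setD(1)[OF C0_pow[OF h(1)]]] by simp
    then show ?case by (simp add: Suc power_mult[symmetric] mult.commute)
  qed
  have n2: "n \<le> 2 ^ n" by (simp add: less_imp_le)
  have "p h ^ n * p h ^ (2 ^ n - n) = p (l1_pow \<alpha> L h (n + (2 ^ n - n)))"
    using n2 by (simp add: two flip: power_add)
  also have "\<dots> \<le> p (l1_pow \<alpha> L h n) * p (l1_pow \<alpha> L h (2 ^ n - n))"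
    unfolding l1_pow_add[OF h(1)] by (rule seminormD(2)[OF p]) (use h C0_pow C0_setD(1) in auto)
  also have "\<dots> \<le> p (l1_pow \<alpha> L h n) * p h ^ (2 ^ n - n)"
    by (intro mult_left_mono seminorm_pow_le[OF p h(1)] seminormD(1)[OF p C0_setD(1)[OF C0_pow[OF h(1)]]])
  finally show ?thesis using ph by simp
qed

text \<open>A point of the support of h^n is a sum of n elements of the support of h. In an abelian
  group only the multiplicities count, each at most n. With d elements in the support of h this
  replaces d^n, which a root of order 2n would not remove, by a polynomial in n.\<close>

lemma card_support_pow:
  assumes h: "h \<in> C0_set \<alpha>"
  shows "card {k. l1_pow \<alpha> L h n k \<noteq> 0} \<le> (n + 1) ^ card {g. h g \<noteq> 0}"
proof -
  define S where "S = {g. h g \<noteq> 0}"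
  have fin: "finite S" unfolding S_def by (rule C0_setD(2)[OF h])
  let ?v = "\<lambda>f. \<Sum>s\<in>S. \<Sum>i<f s :: nat. s"
  have sub: "{k. l1_pow \<alpha> L h n k \<noteq> 0} \<subseteq> ?v ` (S \<rightarrow>\<^sub>E {..n})" for n
  proof (induction n)
    case 0
    have "0 \<in> ?v ` (S \<rightarrow>\<^sub>E {..0})"
      by (rule image_eqI[of _ _ "\<lambda>s\<in>S. 0"]) auto
    then show ?case by (auto simp: l1_pow_0 l1_one_def)
  next
    case (Suc n)
    show ?case
    proof
      fix k assume "k \<in> {k. l1_pow \<alpha> L h (Suc n) k \<noteq> 0}"
      then have "l1_mult \<alpha> L h (l1_pow \<alpha> L h n) k \<noteq> 0" by (simp add: l1_pow_Suc)
      then obtain t k' where k: "k = t + k'" "h t \<noteq> 0" "l1_pow \<alpha> L h n k' \<noteq> 0"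
        using l1_mult_support[OF C0_setD(1)[OF h] C0_setD(1)[OF C0_pow[OF h]]] by blast
      have t: "t \<in> S" using k by (simp add: S_def)
      obtain f where f: "f \<in> S \<rightarrow>\<^sub>E {..n}" "k' = ?v f" using k(3) Suc by blast
      let ?f = "f(t := Suc (f t))"
      have "?v ?f = (\<Sum>s\<in>S. (\<Sum>i<f s. s) + (if s = t then s else 0))"
        by (rule sum.cong) auto
      also have "\<dots> = k" using fin t by (simp add: sum.distrib f(2) k(1) add.commute)
      finally have "k = ?v ?f" by simp
      moreover have "?f \<in> S \<rightarrow>\<^sub>E {..Suc n}"
        using f(1) t by (auto simp: PiE_iff extensional_def le_SucI)
      ultimately show "k \<in> ?v ` (S \<rightarrow>\<^sub>E {..Suc n})" by (rule image_eqI)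
    qed
  qed
  have finE: "finite (S \<rightarrow>\<^sub>E {..n})" using fin by (intro finite_PiE) auto
  have "card {k. l1_pow \<alpha> L h n k \<noteq> 0} \<le> card (?v ` (S \<rightarrow>\<^sub>E {..n}))"
    by (rule card_mono[OF finite_imageI[OF finE] sub])
  also have "\<dots> \<le> card (S \<rightarrow>\<^sub>E {..n})" by (rule card_image_le[OF finE])
  also have "\<dots> = (n + 1) ^ card S" using fin by (simp add: card_PiE)
  finally show ?thesis by (simp add: S_def)
qed

section \<open>The two bounds and the limit\<close>

lemma l1_norm_le_E0:
  assumes b: "b \<in> C0_set \<alpha>"
  shows "l1_norm b \<le> real (card {g. b g \<noteq> 0}) * sqrt (norm (E0 (l1_mult \<alpha> L b (l1_star st b))))"
proof -
  have "l1_norm b = infsum (\<lambda>g. norm (b g)) {g. b g \<noteq> 0}"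
    unfolding l1_norm_def by (rule infsum_cong_neutral) auto
  also have "\<dots> = (\<Sum>g\<in>{g. b g \<noteq> 0}. norm (b g))" using C0_setD(2)[OF b] by simp
  also have "\<dots> \<le> real (card {g. b g \<noteq> 0}) * sqrt (norm (E0 (l1_mult \<alpha> L b (l1_star st b))))"
    by (rule sum_bounded_above) (simp add: real_le_rsqrt norm_coefficient_sq_le_E0[OF b])
  finally show ?thesis .
qed

text \<open>The domination by \<open>l1_norm\<close> in \<open>cstar_seminorm\<close> bounds the
  set, so that \<open>Sup\<close> is an upper bound.\<close>

lemma seminorm_le_crossed_norm:
  assumes "cstar_seminorm sc st \<alpha> L p" "a \<in> l1_set \<alpha>"
  shows "p a \<le> crossed_norm sc st \<alpha> L a"
  unfolding crossed_norm_def
  by (rule cSup_upper) (use assms seminormD(4) in \<open>auto intro!: bdd_aboveI[of _ "l1_norm a"]\<close>)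

text \<open>The upper bound. The exponent is 4k because in each representation
  \<open>T \<omega>\<close> the norm of a a^* is the square of the norm of a.\<close>

lemma norm_E0_pow_le:
  assumes a: "a \<in> C0_set \<alpha>"
  shows "norm (E0 (l1_pow \<alpha> L (l1_mult \<alpha> L a (l1_star st a)) (2 * k))) \<le> crossed_norm sc st \<alpha> L a ^ (4 * k)"
  unfolding E0_def
proof (rule norm_coefficient_le_T)
  let ?h = "l1_mult \<alpha> L a (l1_star st a)"
  have h: "?h \<in> C0_set \<alpha>" by (intro C0_mult C0_star a)
  then show "l1_pow \<alpha> L ?h (2 * k) \<in> C0_set \<alpha>" by (rule C0_pow)
  fix \<omega> :: "'g \<Rightarrow> complex" assume "character \<omega>"
  then have p: "cstar_seminorm sc st \<alpha> L (\<lambda>a. norm (T \<omega> a))" by (rule cstar_seminorm_T)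
  have "norm (T \<omega> (l1_pow \<alpha> L ?h (2 * k))) \<le> norm (T \<omega> ?h) ^ (2 * k)" by (rule seminorm_pow_le[OF p h])
  also have "\<dots> = norm (T \<omega> a) ^ (4 * k)"
    unfolding seminorm_mult_star[OF p C0_setD(1)[OF a]] by (simp flip: power_mult)
  also have "\<dots> \<le> crossed_norm sc st \<alpha> L a ^ (4 * k)"
    by (intro power_mono seminorm_le_crossed_norm[OF p C0_setD(1)[OF a]]) simp
  finally show "norm (T \<omega> (l1_pow \<alpha> L ?h (2 * k))) \<le> crossed_norm sc st \<alpha> L a ^ (4 * k)" .
qed

text \<open>The lower bound: it is uniform in p and therefore passes to the supremum. Replacing p by
  the l1-norm looks wasteful, but on h^k it costs only the size of the support.\<close>

lemma crossed_norm_le: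
  assumes a: "a \<in> C0_set \<alpha>" and k: "0 < k"
  defines "h \<equiv> l1_mult \<alpha> L a (l1_star st a)"
  shows "crossed_norm sc st \<alpha> L a
    \<le> (real (k + 1) ^ card {g. h g \<noteq> 0}) powr (1 / (2 * real k))
      * norm (E0 (l1_pow \<alpha> L h (2 * k))) powr (1 / (4 * real k))"
  unfolding crossed_norm_def
proof (rule cSup_least)
  show "{p a | p. cstar_seminorm sc st \<alpha> L p} \<noteq> {}" using cstar_seminorm_T[OF character_one] by blast
  fix r assume "r \<in> {p a | p. cstar_seminorm sc st \<alpha> L p}"
  then obtain p where p: "cstar_seminorm sc st \<alpha> L p" and r: "r = p a" by blast
  have h: "h \<in> C0_set \<alpha>" unfolding h_def by (intro C0_mult C0_star a)
  have hs: "l1_star st h = h" unfolding h_def by (simp add: C0_star_mult C0_star a)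
  let ?b = "l1_pow \<alpha> L h k" and ?N = "card {g. h g \<noteq> 0}" and ?e = "norm (E0 (l1_pow \<alpha> L h (2 * k)))"
  have r0: "0 \<le> r" unfolding r by (rule seminormD(1)[OF p C0_setD(1)[OF a]])
  have "r ^ (2 * k) = p h ^ k"
    unfolding h_def seminorm_mult_star[OF p C0_setD(1)[OF a]] r by (simp flip: power_mult)
  also have "\<dots> \<le> p ?b" by (rule seminorm_pow_ge[OF p h hs k])
  also have "\<dots> \<le> l1_norm ?b" by (rule seminormD(4)[OF p C0_setD(1)[OF C0_pow[OF h]]])
  also have "\<dots> \<le> real (card {g. ?b g \<noteq> 0}) * sqrt (norm (E0 (l1_mult \<alpha> L ?b (l1_star st ?b))))"
    by (rule l1_norm_le_E0[OF C0_pow[OF h]])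
  also have "l1_mult \<alpha> L ?b (l1_star st ?b) = l1_pow \<alpha> L h (2 * k)"
    using l1_pow_add[OF h, of k k] by (simp add: l1_pow_star[OF h hs] mult_2)
  also have "real (card {g. ?b g \<noteq> 0}) * sqrt ?e \<le> real (k + 1) ^ ?N * sqrt ?e"
    using card_support_pow[OF h, of k]
    by (intro mult_right_mono) (simp_all only: of_nat_le_iff flip: of_nat_power, simp)
  finally have "(r ^ (2 * k)) powr (1 / (2 * real k)) \<le> (real (k + 1) ^ ?N * sqrt ?e) powr (1 / (2 * real k))"
    using r0 by (intro powr_mono2) auto
  moreover have "(r ^ (2 * k)) powr (1 / (2 * real k)) = r"
    using r0 k by (cases "r = 0") (simp_all add: powr_powr flip: powr_realpow)
  moreover have "sqrt ?e powr (1 / (2 * real k)) = ?e powr (1 / (4 * real k))"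
    by (simp add: powr_powr flip: powr_half_sqrt)
  ultimately show "r \<le> (real (k + 1) ^ ?N) powr (1 / (2 * real k)) * ?e powr (1 / (4 * real k))"
    by (simp add: powr_mult)
qed

lemma tendsto_crossed_norm:
  assumes a: "a \<in> C0_set \<alpha>"
  shows "(\<lambda>k. norm (E0 (l1_pow \<alpha> L (l1_mult \<alpha> L a (l1_star st a)) (2 * k))) powr (1 / (4 * real k)))
    \<longlonglongrightarrow> crossed_norm sc st \<alpha> L a"
proof -
  define N where "N = crossed_norm sc st \<alpha> L a"
  define d where "d = card {g. l1_mult \<alpha> L a (l1_star st a) g \<noteq> 0}"
  define e where "e k = norm (E0 (l1_pow \<alpha> L (l1_mult \<alpha> L a (l1_star st a)) (2 * k)))" for k
  define c where "c k = (real (k + 1) ^ d) powr (1 / (2 * real k))" for k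
  have c0: "0 < c k" for k by (simp add: c_def)
  have N0: "0 \<le> N"
    unfolding N_def
    using seminorm_le_crossed_norm[OF cstar_seminorm_T[OF character_one] C0_setD(1)[OF a]] norm_ge_zero order_trans by blast
  \<comment> \<open>The sequence is squeezed between \<open>N / c k\<close> and \<open>N\<close>.
    Index 0 is excluded, since there the exponents 1 / 0 evaluate to 0.\<close>
  have "(\<lambda>k. e k powr (1 / (4 * real k))) \<longlonglongrightarrow> N"
  proof (rule tendsto_sandwich)
    show "\<forall>\<^sub>F k in sequentially. N / c k \<le> e k powr (1 / (4 * real k))"
      using eventually_gt_at_top[of 0]
    proof eventually_elim
      case (elim k)
      then show ?case
        using crossed_norm_le[OF a, of k] c0[of k]
        by (simp add: N_def c_def d_def e_def pos_divide_le_eq mult.commute)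
    qed
    show "\<forall>\<^sub>F k in sequentially. e k powr (1 / (4 * real k)) \<le> N"
      using eventually_gt_at_top[of 0]
    proof eventually_elim
      case (elim k)
      have "e k powr (1 / (4 * real k)) \<le> (N ^ (4 * k)) powr (1 / (4 * real k))"
        unfolding e_def N_def by (intro powr_mono2 norm_E0_pow_le[OF a]) auto
      also have "\<dots> = N"
        using N0 elim by (cases "N = 0") (simp_all add: powr_powr flip: powr_realpow)
      finally show ?case .
    qed
    have "(\<lambda>k. N / c k) \<longlonglongrightarrow> N / 1"
      unfolding c_def by (intro tendsto_intros tendsto_power_powr_inverse) simp
    then show "(\<lambda>k. N / c k) \<longlonglongrightarrow> N" by simp
  qed simp
  then show ?thesis by (simp add: e_def N_def)
qed

end

theorem theorem5p7:
  fixes sc :: "complex \<Rightarrow> 'a::{real_normed_algebra_1,banach} \<Rightarrow> 'a"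
    and st :: "'a \<Rightarrow> 'a"
    and \<alpha> :: "'g::linordered_ab_group_add \<Rightarrow> 'a \<Rightarrow> 'a"
    and L :: "'g \<Rightarrow> 'a \<Rightarrow> 'a"
    and sch :: "complex \<Rightarrow> 'h::banach \<Rightarrow> 'h"
    and ip :: "'h \<Rightarrow> 'h \<Rightarrow> complex"
    and \<pi> :: "'a \<Rightarrow> 'h \<Rightarrow> 'h"
    and U :: "'g \<Rightarrow> 'h \<Rightarrow> 'h"
    and a :: "'g \<Rightarrow> 'a"
  assumes "cstar_algebra sc st"
    and "endo_action sc st \<alpha>"
    and "finely_rep sc st \<alpha> sch ip \<pi> U"
    and "complete_transfer sc st \<alpha> L"
    and "a \<in> C0_set \<alpha>"
  shows "(\<lambda>k. norm (E0 (l1_pow \<alpha> L (l1_mult \<alpha> L a (l1_star st a)) (2 * k)))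
                 powr (1 / (4 * real k)))
         \<longlonglongrightarrow> crossed_norm sc st \<alpha> L a"
proof -
  have "hilbert_space sch ip" using assms(3) by (simp add: finely_rep_def)
  then interpret fine sc st sch ip \<alpha> L \<pi> U
    using assms by unfold_locales
  show ?thesis by (rule tendsto_crossed_norm) fact
qed

end
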